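(* Let $\mathcal{E}$ be a regular ($\mathsf{Pos}$-enriched) category. If a weakening-closed relation $\phi\colon X\looparrowright Y$ has a right adjoint in $\mathrm{Rel}_{w}(\mathcal{E})$, i.e. there is a weakening-closed relation $\psi\colon Y\looparrowright X$ with $I_X\subseteq\psi\phi$ and $\phi\psi\subseteq I_Y$, then there exists a (necessarily unique) morphism $f\colon X\to Y$ in $\mathcal{E}$ such that $\phi=f_{*}$.
   Context: All categories are enriched over the cartesian closed category $\mathsf{Pos}$ of posets and monotone maps: each hom-set is partially ordered and composition is monotone in each variable. Limits are weighted ($\mathsf{Pos}$-enriched); in particular the projections of products and pullbacks are jointly order-monomorphic, where a family $(p_i)$ with common domain is jointly order-monomorphic if $p_iu\le p_iv$ for all $i$ implies $u\le v$. A morphism $m\colon X\to Y$ is an $\mathsf{ff}$-morphism if $mf\le mg$ implies $f\le g$ for all $f,g\colon Z\to X$. A morphism $e\colon A\to B$ is an $\mathsf{so}$-morphism if for every $\mathsf{ff}$-morphism $m\colon X\to Y$ the canonical square from $\mathcal{E}(B,X)$ to $\mathcal{E}(A,X)$, $\mathcal{E}(B,Y)$ over $\mathcal{E}(A,Y)$ (given by composing with $e$ and $m$) is a pullback in $\mathsf{Pos}$. The comma object $f/g$ of $f\colon X\to Z$, $g\colon Y\to Z$ is given by jointly order-monomorphic $c_0\colon f/g\to X$, $c_1\colon f/g\to Y$ with $fc_0\le gc_1$, such that any $u_0,u_1$ with $fu_0\le gu_1$ factor as $u_0=c_0u$, $u_1=c_1u$. A category is regular if it has all finite weighted limits, every morphism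 factors as an $\mathsf{so}$-morphism followed by an $\mathsf{ff}$-morphism, and $\mathsf{so}$-morphisms are stable under pullback. A relation $R\colon X\looparrowright Y$ in a regular category $\mathcal{E}$ is a subobject of $X\times Y$ represented by an $\mathsf{ff}$-morphism $\langle r_0,r_1\rangle\colon R\rightarrowtail X\times Y$; relations are ordered by inclusion $\subseteq$ of subobjects. For $x\colon A\to X$, $y\colon A\to Y$ write $(x,y)\in_A R$ if $\langle x,y\rangle$ factors through $\langle r_0,r_1\rangle$. The composite $SR=S\circ R\colon X\looparrowright Z$ of $R\colon X\looparrowright Y$ and $S\colon Y\looparrowright Z$ is the $\mathsf{ff}$-part of the $(\mathsf{so},\mathsf{ff})$-factorization of $\langle r_0t_0,s_1t_1\rangle\colon T\to X\times Z$, where $(T,t_0,t_1)$ is the pullback of $r_1$ and $s_0$. A relation $R$ is weakening-closed if $x'\le x$, $(x,y)\in_A R$ and $y\le y'$ imply $(x',y')\in_A R$. $\mathrm{Rel}_w(\mathcal{E})$ is the locally posetal bicategory whose objects are those of $\mathcal{E}$ and whose morphisms are the weakening-closed relations, ordered by inclusion, with composition of relations, and with identity on $X$ the relation $I_X:=1_X/1_X$ (so $(x,x')\in_A I_X\iff x\le x'$). For $f\colon X\to Y$ in $\mathcal{E}$, $f_*:=f/1_Y\colon X\looparrowright Y$, i.e. $(x,y)\in_A f_*\iff fx\le y$. *)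

theory Defs
  imports Main
begin

section \<open>Categories enriched in posets\<close>

text \<open>
  The relation \<^emph>\<open>Le\<close> is the order of the hom-posets; it is only meaningful between parallel
  arrows. Composition is written in the usual applicative order.
\<close>

record ('o, 'a) pos_cat =
  Obj :: "'o set"
  Arr :: "'a set"
  Dom :: "'a \<Rightarrow> 'o"
  Cod :: "'a \<Rightarrow> 'o"
  Ide :: "'o \<Rightarrow> 'a"
  Comp :: "'a \<Rightarrow> 'a \<Rightarrow> 'a"  (infixl "\<cdot>\<index>" 70)
  Le :: "'a \<Rightarrow> 'a \<Rightarrow> bool"  (infix "\<preceq>\<index>" 50)

definition hom :: "('o, 'a) pos_cat \<Rightarrow> 'o \<Rightarrow> 'o \<Rightarrow> 'a set" where
  "hom C X Y = {f \<in> Arr C. Dom C f = X \<and> Cod C f = Y}"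

locale pos_category =
  fixes C :: "('o, 'a) pos_cat"  (structure)
  assumes dom_obj: "f \<in> Arr C \<Longrightarrow> Dom C f \<in> Obj C"
    and cod_obj: "f \<in> Arr C \<Longrightarrow> Cod C f \<in> Obj C"
    and ide_hom: "X \<in> Obj C \<Longrightarrow> Ide C X \<in> hom C X X"
    and comp_hom: "\<lbrakk>f \<in> hom C X Y; g \<in> hom C Y Z\<rbrakk> \<Longrightarrow> g \<cdot> f \<in> hom C X Z"
    and comp_ide_right: "f \<in> hom C X Y \<Longrightarrow> f \<cdot> Ide C X = f"
    and comp_ide_left: "f \<in> hom C X Y \<Longrightarrow> Ide C Y \<cdot> f = f"
    and comp_assoc:
      "\<lbrakk>f \<in> hom C W X; g \<in> hom C X Y; h \<in> hom C Y Z\<rbrakk> \<Longrightarrow> (h \<cdot> g) \<cdot> f = h \<cdot> (g \<cdot> f)"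
    and le_refl: "f \<in> hom C X Y \<Longrightarrow> f \<preceq> f"
    and le_antisym: "\<lbrakk>f \<in> hom C X Y; g \<in> hom C X Y; f \<preceq> g; g \<preceq> f\<rbrakk> \<Longrightarrow> f = g"
    and le_trans:
      "\<lbrakk>f \<in> hom C X Y; g \<in> hom C X Y; h \<in> hom C X Y; f \<preceq> g; g \<preceq> h\<rbrakk> \<Longrightarrow> f \<preceq> h"
    and comp_mono:
      "\<lbrakk>f \<in> hom C X Y; f' \<in> hom C X Y; g \<in> hom C Y Z; g' \<in> hom C Y Z; f \<preceq> f'; g \<preceq> g'\<rbrakk>
        \<Longrightarrow> g \<cdot> f \<preceq> g' \<cdot> f'"


section \<open>Weighted limits\<close>

text \<open>A functor between categories enriched in posets is locally monotone.\<close>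

locale pos_functor =
  fixes D :: "('i, 'j) pos_cat" and C :: "('o, 'a) pos_cat"
    and Fo :: "'i \<Rightarrow> 'o" and Fa :: "'j \<Rightarrow> 'a"
  assumes functor_obj: "i \<in> Obj D \<Longrightarrow> Fo i \<in> Obj C"
    and functor_hom: "d \<in> hom D i j \<Longrightarrow> Fa d \<in> hom C (Fo i) (Fo j)"
    and functor_ide: "i \<in> Obj D \<Longrightarrow> Fa (Ide D i) = Ide C (Fo i)"
    and functor_comp:
      "\<lbrakk>d \<in> hom D i j; e \<in> hom D j k\<rbrakk> \<Longrightarrow> Fa (e \<cdot>\<^bsub>D\<^esub> d) = Fa e \<cdot>\<^bsub>C\<^esub> Fa d"
    and functor_mono:
      "\<lbrakk>d \<in> hom D i j; e \<in> hom D i j; d \<preceq>\<^bsub>D\<^esub> e\<rbrakk> \<Longrightarrow> Fa d \<preceq>\<^bsub>C\<^esub> Fa e"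

text \<open>
  A weight is an enriched functor from \<^emph>\<open>D\<close> to posets: the value at \<^emph>\<open>i\<close> is the poset with
  carrier \<^emph>\<open>Wo i\<close> and order \<^emph>\<open>Wle i\<close>, and \<^emph>\<open>Wa d\<close> is the monotone map assigned to the
  arrow \<^emph>\<open>d\<close>. Monotone maps are ordered pointwise.
\<close>

locale pos_weight =
  fixes D :: "('i, 'j) pos_cat"
    and Wo :: "'i \<Rightarrow> 'w set" and Wle :: "'i \<Rightarrow> 'w \<Rightarrow> 'w \<Rightarrow> bool" and Wa :: "'j \<Rightarrow> 'w \<Rightarrow> 'w"
  assumes weight_refl: "\<lbrakk>i \<in> Obj D; w \<in> Wo i\<rbrakk> \<Longrightarrow> Wle i w w"
    and weight_antisym:
      "\<lbrakk>i \<in> Obj D; w \<in> Wo i; w' \<in> Wo i; Wle i w w'; Wle i w' w\<rbrakk> \<Longrightarrow> w = w'"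
    and weight_trans:
      "\<lbrakk>i \<in> Obj D; w \<in> Wo i; w' \<in> Wo i; w'' \<in> Wo i; Wle i w w'; Wle i w' w''\<rbrakk>
        \<Longrightarrow> Wle i w w''"
    and weight_map: "\<lbrakk>d \<in> hom D i j; w \<in> Wo i\<rbrakk> \<Longrightarrow> Wa d w \<in> Wo j"
    and weight_map_mono:
      "\<lbrakk>d \<in> hom D i j; w \<in> Wo i; w' \<in> Wo i; Wle i w w'\<rbrakk> \<Longrightarrow> Wle j (Wa d w) (Wa d w')"
    and weight_ide: "\<lbrakk>i \<in> Obj D; w \<in> Wo i\<rbrakk> \<Longrightarrow> Wa (Ide D i) w = w"
    and weight_comp:
      "\<lbrakk>d \<in> hom D i j; e \<in> hom D j k; w \<in> Wo i\<rbrakk> \<Longrightarrow> Wa (e \<cdot>\<^bsub>D\<^esub> d) w = Wa e (Wa d w)"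
    and weight_mono:
      "\<lbrakk>d \<in> hom D i j; e \<in> hom D i j; d \<preceq>\<^bsub>D\<^esub> e; w \<in> Wo i\<rbrakk> \<Longrightarrow> Wle j (Wa d w) (Wa e w)"

text \<open>
  A cylinder with vertex \<^emph>\<open>A\<close> is an enriched natural transformation from the weight to
  \<^emph>\<open>C(A, F-)\<close>.
\<close>

definition weighted_cylinder ::
  "('i, 'j) pos_cat \<Rightarrow> ('i \<Rightarrow> 'w set) \<Rightarrow> ('i \<Rightarrow> 'w \<Rightarrow> 'w \<Rightarrow> bool) \<Rightarrow> ('j \<Rightarrow> 'w \<Rightarrow> 'w) \<Rightarrow>
   ('o, 'a) pos_cat \<Rightarrow> ('i \<Rightarrow> 'o) \<Rightarrow> ('j \<Rightarrow> 'a) \<Rightarrow> 'o \<Rightarrow> ('i \<Rightarrow> 'w \<Rightarrow> 'a) \<Rightarrow> bool" where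
  "weighted_cylinder D Wo Wle Wa C Fo Fa A \<mu> \<longleftrightarrow>
     (\<forall>i \<in> Obj D. \<forall>w \<in> Wo i. \<mu> i w \<in> hom C A (Fo i)) \<and>
     (\<forall>i \<in> Obj D. \<forall>w \<in> Wo i. \<forall>w' \<in> Wo i. Wle i w w' \<longrightarrow> \<mu> i w \<preceq>\<^bsub>C\<^esub> \<mu> i w') \<and>
     (\<forall>i \<in> Obj D. \<forall>j \<in> Obj D. \<forall>d \<in> hom D i j. \<forall>w \<in> Wo i. Fa d \<cdot>\<^bsub>C\<^esub> \<mu> i w = \<mu> j (Wa d w))"

text \<open>
  The limit is a cylinder such that composition with it is an isomorphism of posets from
  \<^emph>\<open>C(A, L)\<close> to the poset of cylinders with vertex \<^emph>\<open>A\<close>, for every object \<^emph>\<open>A\<close>.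
\<close>

definition is_weighted_limit ::
  "('i, 'j) pos_cat \<Rightarrow> ('i \<Rightarrow> 'w set) \<Rightarrow> ('i \<Rightarrow> 'w \<Rightarrow> 'w \<Rightarrow> bool) \<Rightarrow> ('j \<Rightarrow> 'w \<Rightarrow> 'w) \<Rightarrow>
   ('o, 'a) pos_cat \<Rightarrow> ('i \<Rightarrow> 'o) \<Rightarrow> ('j \<Rightarrow> 'a) \<Rightarrow> 'o \<Rightarrow> ('i \<Rightarrow> 'w \<Rightarrow> 'a) \<Rightarrow> bool" where
  "is_weighted_limit D Wo Wle Wa C Fo Fa L \<kappa> \<longleftrightarrow>
     L \<in> Obj C \<and> weighted_cylinder D Wo Wle Wa C Fo Fa L \<kappa> \<and>
     (\<forall>A \<in> Obj C. \<forall>\<mu>. weighted_cylinder D Wo Wle Wa C Fo Fa A \<mu> \<longrightarrow>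
        (\<exists>u \<in> hom C A L. \<forall>i \<in> Obj D. \<forall>w \<in> Wo i. \<kappa> i w \<cdot>\<^bsub>C\<^esub> u = \<mu> i w)) \<and>
     (\<forall>A \<in> Obj C. \<forall>u \<in> hom C A L. \<forall>v \<in> hom C A L.
        (\<forall>i \<in> Obj D. \<forall>w \<in> Wo i. \<kappa> i w \<cdot>\<^bsub>C\<^esub> u \<preceq>\<^bsub>C\<^esub> \<kappa> i w \<cdot>\<^bsub>C\<^esub> v) \<longrightarrow> u \<preceq>\<^bsub>C\<^esub> v)"

text \<open>
  A weight is finite if its domain has finitely many objects and arrows and its values are
  finite posets (the finitely presentable objects in the category of posets). Up to
  isomorphism such data live on natural numbers, so indexing by \<^typ>\<open>nat\<close> loses no generality.
\<close>

definition has_finite_weighted_limits :: "('o, 'a) pos_cat \<Rightarrow> bool" where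
  "has_finite_weighted_limits C \<longleftrightarrow>
     (\<forall>(D :: (nat, nat) pos_cat) (Wo :: nat \<Rightarrow> nat set) Wle Wa Fo Fa.
        pos_category D \<and> finite (Obj D) \<and> finite (Arr D) \<and>
        pos_weight D Wo Wle Wa \<and> (\<forall>i \<in> Obj D. finite (Wo i)) \<and>
        pos_functor D C Fo Fa \<longrightarrow>
        (\<exists>L \<kappa>. is_weighted_limit D Wo Wle Wa C Fo Fa L \<kappa>))"


section \<open>Products, pullbacks and comma objects\<close>

definition jointly_order_mono :: "('o, 'a) pos_cat \<Rightarrow> 'o \<Rightarrow> 'a \<Rightarrow> 'a \<Rightarrow> bool" where
  "jointly_order_mono C P p q \<longleftrightarrow>
     (\<forall>A \<in> Obj C. \<forall>u \<in> hom C A P. \<forall>v \<in> hom C A P.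
        p \<cdot>\<^bsub>C\<^esub> u \<preceq>\<^bsub>C\<^esub> p \<cdot>\<^bsub>C\<^esub> v \<and> q \<cdot>\<^bsub>C\<^esub> u \<preceq>\<^bsub>C\<^esub> q \<cdot>\<^bsub>C\<^esub> v \<longrightarrow> u \<preceq>\<^bsub>C\<^esub> v)"

definition is_product ::
  "('o, 'a) pos_cat \<Rightarrow> 'o \<Rightarrow> 'o \<Rightarrow> 'o \<Rightarrow> 'a \<Rightarrow> 'a \<Rightarrow> bool" where
  "is_product C X Y P p q \<longleftrightarrow>
     P \<in> Obj C \<and> p \<in> hom C P X \<and> q \<in> hom C P Y \<and> jointly_order_mono C P p q \<and>
     (\<forall>A \<in> Obj C. \<forall>u \<in> hom C A X. \<forall>v \<in> hom C A Y.
        \<exists>h \<in> hom C A P. p \<cdot>\<^bsub>C\<^esub> h = u \<and> q \<cdot>\<^bsub>C\<^esub> h = v)"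

definition is_pullback ::
  "('o, 'a) pos_cat \<Rightarrow> 'a \<Rightarrow> 'a \<Rightarrow> 'o \<Rightarrow> 'a \<Rightarrow> 'a \<Rightarrow> bool" where
  "is_pullback C f g P p q \<longleftrightarrow>
     f \<in> Arr C \<and> g \<in> Arr C \<and> Cod C f = Cod C g \<and>
     P \<in> Obj C \<and> p \<in> hom C P (Dom C f) \<and> q \<in> hom C P (Dom C g) \<and>
     f \<cdot>\<^bsub>C\<^esub> p = g \<cdot>\<^bsub>C\<^esub> q \<and> jointly_order_mono C P p q \<and>
     (\<forall>A \<in> Obj C. \<forall>u \<in> hom C A (Dom C f). \<forall>v \<in> hom C A (Dom C g).
        f \<cdot>\<^bsub>C\<^esub> u = g \<cdot>\<^bsub>C\<^esub> v \<longrightarrow> (\<exists>h \<in> hom C A P. p \<cdot>\<^bsub>C\<^esub> h = u \<and> q \<cdot>\<^bsub>C\<^esub> h = v))"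

definition is_comma ::
  "('o, 'a) pos_cat \<Rightarrow> 'a \<Rightarrow> 'a \<Rightarrow> 'o \<Rightarrow> 'a \<Rightarrow> 'a \<Rightarrow> bool" where
  "is_comma C f g K c\<^sub>0 c\<^sub>1 \<longleftrightarrow>
     f \<in> Arr C \<and> g \<in> Arr C \<and> Cod C f = Cod C g \<and>
     K \<in> Obj C \<and> c\<^sub>0 \<in> hom C K (Dom C f) \<and> c\<^sub>1 \<in> hom C K (Dom C g) \<and>
     f \<cdot>\<^bsub>C\<^esub> c\<^sub>0 \<preceq>\<^bsub>C\<^esub> g \<cdot>\<^bsub>C\<^esub> c\<^sub>1 \<and> jointly_order_mono C K c\<^sub>0 c\<^sub>1 \<and>
     (\<forall>A \<in> Obj C. \<forall>u \<in> hom C A (Dom C f). \<forall>v \<in> hom C A (Dom C g).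
        f \<cdot>\<^bsub>C\<^esub> u \<preceq>\<^bsub>C\<^esub> g \<cdot>\<^bsub>C\<^esub> v \<longrightarrow> (\<exists>h \<in> hom C A K. c\<^sub>0 \<cdot>\<^bsub>C\<^esub> h = u \<and> c\<^sub>1 \<cdot>\<^bsub>C\<^esub> h = v))"


section \<open>Regular categories\<close>

definition ff_mor :: "('o, 'a) pos_cat \<Rightarrow> 'a \<Rightarrow> bool" where
  "ff_mor C m \<longleftrightarrow> m \<in> Arr C \<and>
     (\<forall>Z \<in> Obj C. \<forall>f \<in> hom C Z (Dom C m). \<forall>g \<in> hom C Z (Dom C m).
        m \<cdot>\<^bsub>C\<^esub> f \<preceq>\<^bsub>C\<^esub> m \<cdot>\<^bsub>C\<^esub> g \<longrightarrow> f \<preceq>\<^bsub>C\<^esub> g)"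

text \<open>
  For \<^emph>\<open>e : A \<rightarrow> B\<close> and \<^emph>\<open>m : X \<rightarrow> Y\<close>, the square of hom-posets is a pullback of posets iff
  \<^emph>\<open>h \<mapsto> (h e, m h)\<close> is an order isomorphism from \<^emph>\<open>C(B, X)\<close> onto the set of pairs
  \<^emph>\<open>(u, v)\<close> with \<^emph>\<open>m u = v e\<close>, ordered componentwise. It is always monotone, so only
  bijectivity and order reflection are stated.
\<close>

definition so_square_pullback :: "('o, 'a) pos_cat \<Rightarrow> 'a \<Rightarrow> 'a \<Rightarrow> bool" where
  "so_square_pullback C e m \<longleftrightarrow>
     bij_betw (\<lambda>h. (h \<cdot>\<^bsub>C\<^esub> e, m \<cdot>\<^bsub>C\<^esub> h)) (hom C (Cod C e) (Dom C m))
       {(u, v). u \<in> hom C (Dom C e) (Dom C m) \<and> v \<in> hom C (Cod C e) (Cod C m) \<and>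
                m \<cdot>\<^bsub>C\<^esub> u = v \<cdot>\<^bsub>C\<^esub> e} \<and>
     (\<forall>h \<in> hom C (Cod C e) (Dom C m). \<forall>k \<in> hom C (Cod C e) (Dom C m).
        h \<cdot>\<^bsub>C\<^esub> e \<preceq>\<^bsub>C\<^esub> k \<cdot>\<^bsub>C\<^esub> e \<and> m \<cdot>\<^bsub>C\<^esub> h \<preceq>\<^bsub>C\<^esub> m \<cdot>\<^bsub>C\<^esub> k \<longrightarrow> h \<preceq>\<^bsub>C\<^esub> k)"

definition so_mor :: "('o, 'a) pos_cat \<Rightarrow> 'a \<Rightarrow> bool" where
  "so_mor C e \<longleftrightarrow> e \<in> Arr C \<and> (\<forall>m. ff_mor C m \<longrightarrow> so_square_pullback C e m)"

definition so_ff_factorization :: "('o, 'a) pos_cat \<Rightarrow> 'a \<Rightarrow> 'a \<Rightarrow> 'a \<Rightarrow> bool" where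
  "so_ff_factorization C f e m \<longleftrightarrow>
     so_mor C e \<and> ff_mor C m \<and> Cod C e = Dom C m \<and> f = m \<cdot>\<^bsub>C\<^esub> e"

locale regular_pos_category = pos_category +
  assumes finite_limits: "has_finite_weighted_limits C"
    and factorization: "f \<in> Arr C \<Longrightarrow> \<exists>e m. so_ff_factorization C f e m"
    and so_stable: "\<lbrakk>is_pullback C f e P p q; so_mor C e\<rbrakk> \<Longrightarrow> so_mor C p"


section \<open>Relations as subobjects of products\<close>

text \<open>
  A choice of binary products; nothing below depends on it up to isomorphism.
\<close>

definition prod_cone :: "('o, 'a) pos_cat \<Rightarrow> 'o \<Rightarrow> 'o \<Rightarrow> 'o \<times> 'a \<times> 'a" where
  "prod_cone C X Y = (SOME (P, p, q). is_product C X Y P p q)"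

definition prod_obj :: "('o, 'a) pos_cat \<Rightarrow> 'o \<Rightarrow> 'o \<Rightarrow> 'o" where
  "prod_obj C X Y = fst (prod_cone C X Y)"

definition proj\<^sub>0 :: "('o, 'a) pos_cat \<Rightarrow> 'o \<Rightarrow> 'o \<Rightarrow> 'a" where
  "proj\<^sub>0 C X Y = fst (snd (prod_cone C X Y))"

definition proj\<^sub>1 :: "('o, 'a) pos_cat \<Rightarrow> 'o \<Rightarrow> 'o \<Rightarrow> 'a" where
  "proj\<^sub>1 C X Y = snd (snd (prod_cone C X Y))"

definition pairing :: "('o, 'a) pos_cat \<Rightarrow> 'a \<Rightarrow> 'a \<Rightarrow> 'a" where
  "pairing C x y =
     (THE h. h \<in> hom C (Dom C x) (prod_obj C (Cod C x) (Cod C y)) \<and>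
             proj\<^sub>0 C (Cod C x) (Cod C y) \<cdot>\<^bsub>C\<^esub> h = x \<and> proj\<^sub>1 C (Cod C x) (Cod C y) \<cdot>\<^bsub>C\<^esub> h = y)"

definition factors_through :: "('o, 'a) pos_cat \<Rightarrow> 'a \<Rightarrow> 'a \<Rightarrow> bool" where
  "factors_through C f m \<longleftrightarrow> (\<exists>h \<in> hom C (Dom C f) (Dom C m). f = m \<cdot>\<^bsub>C\<^esub> h)"

text \<open>
  A subobject is an equivalence class of \<^emph>\<open>ff\<close>-morphisms with common codomain, two of them being
  equivalent if each factors through the other; so equality of relations below is equality of
  subobjects.
\<close>

definition subobjects :: "('o, 'a) pos_cat \<Rightarrow> 'o \<Rightarrow> 'a set set" where
  "subobjects C P =
     {m. ff_mor C m \<and> Cod C m = P} //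
     {(m, n). ff_mor C m \<and> Cod C m = P \<and> ff_mor C n \<and> Cod C n = P \<and>
              factors_through C m n \<and> factors_through C n m}"

definition sub_le :: "('o, 'a) pos_cat \<Rightarrow> 'a set \<Rightarrow> 'a set \<Rightarrow> bool" where
  "sub_le C R S \<longleftrightarrow> (\<exists>m \<in> R. \<exists>n \<in> S. factors_through C m n)"

definition in_rel :: "('o, 'a) pos_cat \<Rightarrow> 'a \<Rightarrow> 'a \<Rightarrow> 'a set \<Rightarrow> bool" where
  "in_rel C x y R \<longleftrightarrow> (\<exists>m \<in> R. factors_through C (pairing C x y) m)"

definition weakening_closed :: "('o, 'a) pos_cat \<Rightarrow> 'o \<Rightarrow> 'o \<Rightarrow> 'a set \<Rightarrow> bool" where
  "weakening_closed C X Y R \<longleftrightarrow>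
     (\<forall>A \<in> Obj C. \<forall>x \<in> hom C A X. \<forall>x' \<in> hom C A X. \<forall>y \<in> hom C A Y. \<forall>y' \<in> hom C A Y.
        x' \<preceq>\<^bsub>C\<^esub> x \<and> in_rel C x y R \<and> y \<preceq>\<^bsub>C\<^esub> y' \<longrightarrow> in_rel C x' y' R)"

text \<open>
  The composite of \<^emph>\<open>R : X \<rightarrow> Y\<close> and \<^emph>\<open>S : Y \<rightarrow> Z\<close>, as the class of all \<^emph>\<open>ff\<close>-parts obtained
  from all choices of representatives, pullback and factorization. In a regular category these
  form exactly one equivalence class.
\<close>

definition rel_comp ::
  "('o, 'a) pos_cat \<Rightarrow> 'o \<Rightarrow> 'o \<Rightarrow> 'o \<Rightarrow> 'a set \<Rightarrow> 'a set \<Rightarrow> 'a set" where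
  "rel_comp C X Y Z S R =
     {m. \<exists>r \<in> R. \<exists>s \<in> S. \<exists>T t\<^sub>0 t\<^sub>1 e.
        is_pullback C (proj\<^sub>1 C X Y \<cdot>\<^bsub>C\<^esub> r) (proj\<^sub>0 C Y Z \<cdot>\<^bsub>C\<^esub> s) T t\<^sub>0 t\<^sub>1 \<and>
        so_ff_factorization C
          (pairing C ((proj\<^sub>0 C X Y \<cdot>\<^bsub>C\<^esub> r) \<cdot>\<^bsub>C\<^esub> t\<^sub>0) ((proj\<^sub>1 C Y Z \<cdot>\<^bsub>C\<^esub> s) \<cdot>\<^bsub>C\<^esub> t\<^sub>1)) e m}"

text \<open>
  The relation \<^emph>\<open>f/g : X \<rightarrow> Y\<close> of \<^emph>\<open>f : X \<rightarrow> Z\<close> and \<^emph>\<open>g : Y \<rightarrow> Z\<close>, as the class of all its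
  representing arrows into the product of \<^emph>\<open>X\<close> and \<^emph>\<open>Y\<close>, one for each comma object.
\<close>

definition comma_rel :: "('o, 'a) pos_cat \<Rightarrow> 'a \<Rightarrow> 'a \<Rightarrow> 'a set" where
  "comma_rel C f g = {pairing C c\<^sub>0 c\<^sub>1 | K c\<^sub>0 c\<^sub>1. is_comma C f g K c\<^sub>0 c\<^sub>1}"


section \<open>Weakening-closed relations\<close>

text \<open>
  An arrow is a triple of domain, subobject and codomain.
\<close>

definition Rel_w :: "('o, 'a) pos_cat \<Rightarrow> ('o, 'o \<times> 'a set \<times> 'o) pos_cat" where
  "Rel_w C =
     \<lparr>Obj = Obj C,
      Arr = {(X, R, Y). X \<in> Obj C \<and> Y \<in> Obj C \<and>
               R \<in> subobjects C (prod_obj C X Y) \<and> weakening_closed C X Y R},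
      Dom = (\<lambda>(X, R, Y). X),
      Cod = (\<lambda>(X, R, Y). Y),
      Ide = (\<lambda>X. (X, comma_rel C (Ide C X) (Ide C X), X)),
      Comp = (\<lambda>(Y', S, Z) (X, R, Y). (X, rel_comp C X Y Z S R, Z)),
      Le = (\<lambda>(X, R, Y) (X', S, Y'). sub_le C R S)\<rparr>"

definition lower_star :: "('o, 'a) pos_cat \<Rightarrow> 'a \<Rightarrow> 'o \<times> 'a set \<times> 'o" where
  "lower_star C f = (Dom C f, comma_rel C f (Ide C (Cod C f)), Cod C f)"

definition has_right_adjoint :: "('o, 'a) pos_cat \<Rightarrow> 'a \<Rightarrow> bool" where
  "has_right_adjoint K \<phi> \<longleftrightarrow>
     (\<exists>\<psi> \<in> hom K (Cod K \<phi>) (Dom K \<phi>).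
        Ide K (Dom K \<phi>) \<preceq>\<^bsub>K\<^esub> \<psi> \<cdot>\<^bsub>K\<^esub> \<phi> \<and> \<phi> \<cdot>\<^bsub>K\<^esub> \<psi> \<preceq>\<^bsub>K\<^esub> Ide K (Cod K \<phi>))"

end

theory Submission
  imports Defs
begin

text \<open>
  Let \<open>\<psi>\<close> be the right adjoint of \<open>\<phi>\<close>. The unit yields an \<open>so\<close>-morphism \<open>e : A \<rightarrow> X\<close> and an
  arrow \<open>y : A \<rightarrow> Y\<close> with \<open>(e, y) \<in> \<phi>\<close> and \<open>(y, e) \<in> \<psi>\<close>, and the counit together with weakening
  shows that \<open>e u \<le> e v\<close> implies \<open>y u \<le> y v\<close>. Factor \<open>\<langle>e, y\<rangle>\<close> as an \<open>so\<close>-morphism followed by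
  an \<open>ff\<close>-morphism \<open>\<langle>g, h\<rangle>\<close>. Testing on \<open>so\<close>-covers, \<open>g\<close> is an \<open>ff\<close>-morphism through which
  the \<open>so\<close>-morphism \<open>e\<close> factors, so \<open>g\<close> has a section \<open>j\<close>, and \<open>f = h j\<close> satisfies \<open>f e = y\<close>.
  Descent along \<open>e\<close> gives \<open>(1, f) \<in> \<phi>\<close> and \<open>(f, 1) \<in> \<psi>\<close>, whence \<open>(u, v) \<in> \<phi>\<close> iff \<open>f u \<le> v\<close>.
\<close>

section \<open>Hom-posets\<close>

lemma homD:
  assumes "f \<in> hom C X Y"
  shows "f \<in> Arr C" "Dom C f = X" "Cod C f = Y"
  using assms by (auto simp: hom_def)

lemma homI: "f \<in> Arr C \<Longrightarrow> f \<in> hom C (Dom C f) (Cod C f)"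
  by (simp add: hom_def)

context pos_category
begin

lemma hom_dom_obj: "f \<in> hom C X Y \<Longrightarrow> X \<in> Obj C"
  using dom_obj by (auto simp: hom_def)

lemma hom_cod_obj: "f \<in> hom C X Y \<Longrightarrow> Y \<in> Obj C"
  using cod_obj by (auto simp: hom_def)

lemma comp_mono_left:
  "\<lbrakk>u \<in> hom C A B; v \<in> hom C A B; g \<in> hom C B D; u \<preceq> v\<rbrakk> \<Longrightarrow> g \<cdot> u \<preceq> g \<cdot> v"
  by (meson comp_mono le_refl)

lemma comp_mono_right:
  "\<lbrakk>u \<in> hom C B D; v \<in> hom C B D; g \<in> hom C A B; u \<preceq> v\<rbrakk> \<Longrightarrow> u \<cdot> g \<preceq> v \<cdot> g"
  by (meson comp_mono le_refl)

text \<open>Surjectivity of the comparison map into the pullback of hom-posets, read as the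
  existence of a diagonal in the square with left side \<open>e\<close> and right side
  \<open>m\<close>.\<close>

lemma so_diagonal:
  assumes e: "so_mor C e" "e \<in> hom C A B" and m: "ff_mor C m" "m \<in> hom C P Q"
    and u: "u \<in> hom C A P" and v: "v \<in> hom C B Q" and eq: "m \<cdot> u = v \<cdot> e"
  obtains h where "h \<in> hom C B P" "h \<cdot> e = u" "m \<cdot> h = v"
proof -
  have "bij_betw (\<lambda>h. (h \<cdot> e, m \<cdot> h)) (hom C B P)
      {(u, v). u \<in> hom C A P \<and> v \<in> hom C B Q \<and> m \<cdot> u = v \<cdot> e}"
    using e m by (auto simp: so_mor_def so_square_pullback_def homD)
  moreover have "(u, v) \<in> {(u, v). u \<in> hom C A P \<and> v \<in> hom C B Q \<and> m \<cdot> u = v \<cdot> e}"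
    using u v eq by simp
  ultimately have "(u, v) \<in> (\<lambda>h. (h \<cdot> e, m \<cdot> h)) ` hom C B P"
    by (simp only: bij_betw_imp_surj_on)
  then show thesis
    using that by auto
qed

section \<open>The factorization preorder on arrows with common codomain\<close>

lemma factors_through_iff:
  assumes "f \<in> hom C A P" "m \<in> hom C M P"
  shows "factors_through C f m \<longleftrightarrow> (\<exists>h \<in> hom C A M. f = m \<cdot> h)"
  using assms by (simp add: factors_through_def homD)

lemma factors_through_refl: "f \<in> Arr C \<Longrightarrow> factors_through C f f"
  unfolding factors_through_def
  by (metis comp_ide_right dom_obj homI ide_hom)

lemma factors_through_trans:
  assumes "f \<in> hom C A P" "m \<in> hom C M P" "n \<in> hom C N P"
    and "factors_through C f m" "factors_through C m n"
  shows "factors_through C f n"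
proof -
  from assms obtain h k where "h \<in> hom C A M" "f = m \<cdot> h" "k \<in> hom C M N" "m = n \<cdot> k"
    by (auto simp: factors_through_iff)
  then show ?thesis
    using assms(1,3) comp_assoc[of h A M k N n P] comp_hom[of h A M k N]
    by (auto simp: factors_through_iff)
qed

section \<open>Subobjects\<close>

text \<open>The arrow generating an equivalence class lies in it, since every arrow factors through
  itself.\<close>

lemma subobject_rep:
  assumes "R \<in> subobjects C P"
  obtains r where "r \<in> R"
proof -
  from assms obtain r where
    "R = {(m, n). ff_mor C m \<and> Cod C m = P \<and> ff_mor C n \<and> Cod C n = P \<and>
              factors_through C m n \<and> factors_through C n m} `` {r}" "ff_mor C r" "Cod C r = P"
    unfolding subobjects_def by (auto elim: quotientE)
  then have "r \<in> R"
    using factors_through_refl by (auto simp: ff_mor_def)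
  then show thesis by (rule that)
qed

lemma subobject_ff:
  assumes "R \<in> subobjects C P" "r \<in> R"
  shows "ff_mor C r" "r \<in> hom C (Dom C r) P"
  using assms by (auto simp: subobjects_def quotient_def ff_mor_def hom_def)

text \<open>Go through the arrow \<open>s\<close> that generates the class: \<open>r\<close> factors
  through \<open>s\<close>, and \<open>s\<close> through \<open>r'\<close>.\<close>

lemma subobject_factors:
  assumes "R \<in> subobjects C P" "r \<in> R" "r' \<in> R"
  shows "factors_through C r r'"
proof -
  from assms obtain s where "factors_through C r s" "factors_through C s r'"
    "s \<in> hom C (Dom C s) P"
    by (auto simp: subobjects_def quotient_def ff_mor_def hom_def)
  then show ?thesis
    using factors_through_trans subobject_ff(2)[OF assms(1,2)] subobject_ff(2)[OF assms(1,3)]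
    by blast
qed

text \<open>Subobjects are saturated classes. This is what allows equality of relations to be proved
  as equality of sets of representatives.\<close>

lemma subobject_closed:
  assumes R: "R \<in> subobjects C P" "r \<in> R" and n: "ff_mor C n" "n \<in> hom C N P"
    and f: "factors_through C r n" "factors_through C n r"
  shows "n \<in> R"
proof -
  from R(1) obtain s where s: "ff_mor C s" "Cod C s = P" and
    Rs: "R = {(m, n). ff_mor C m \<and> Cod C m = P \<and> ff_mor C n \<and> Cod C n = P \<and>
              factors_through C m n \<and> factors_through C n m} `` {s}"
    unfolding subobjects_def by (auto elim: quotientE)
  have sh: "s \<in> hom C (Dom C s) P"
    using s by (auto simp: ff_mor_def hom_def)
  note rh = subobject_ff(2)[OF R]
  have "factors_through C s r" "factors_through C r s"
    using R(2) Rs by auto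
  then have "factors_through C s n" "factors_through C n s"
    using f factors_through_trans sh rh n(2) by blast+
  then show ?thesis
    using Rs s n by (auto simp: homD)
qed

end

section \<open>Products, pullbacks and powers from weighted limits\<close>

text \<open>Each object doubles as its own identity arrow. Composable arrows are equal, so the
  composite may be taken to be either of them. The natural numbers serve as indices because
  \<open>has_finite_weighted_limits\<close> quantifies over such diagrams.\<close>

definition discrete_cat :: "nat set \<Rightarrow> (nat, nat) pos_cat" where
  "discrete_cat N = \<lparr>Obj = N, Arr = N, Dom = \<lambda>i. i, Cod = \<lambda>i. i, Ide = \<lambda>i. i,
     Comp = \<lambda>i j. i, Le = (=)\<rparr>"

lemma hom_discrete: "d \<in> hom (discrete_cat N) i j \<longleftrightarrow> d = i \<and> j = i \<and> i \<in> N"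
  by (auto simp: discrete_cat_def hom_def)

lemma pos_category_discrete: "pos_category (discrete_cat N)"
  by unfold_locales (auto simp: hom_discrete, auto simp: discrete_cat_def)

text \<open>The arrows \<open>0, 1, 2\<close> are identities, \<open>3 : 0 \<rightarrow> 2\<close> and \<open>4 : 1 \<rightarrow> 2\<close>.\<close>

definition cospan_cat :: "(nat, nat) pos_cat" where
  "cospan_cat = \<lparr>Obj = {0, 1, 2}, Arr = {0, 1, 2, 3, 4}, Dom = \<lambda>d. if d < 3 then d else d - 3,
     Cod = \<lambda>d. if d < 3 then d else 2, Ide = \<lambda>i. i,
     Comp = \<lambda>e d. if e < 3 then d else e, Le = (=)\<rparr>"

lemma hom_cospan:
  "d \<in> hom cospan_cat i j \<longleftrightarrow>
     d = i \<and> j = i \<and> i \<in> {0, 1, 2} \<or> d = 3 \<and> i = 0 \<and> j = 2 \<or> d = 4 \<and> i = 1 \<and> j = 2"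
  by (auto simp: cospan_cat_def hom_def)

lemma cospan_simps:
  "Obj cospan_cat = {0, 1, 2}" "Arr cospan_cat = {0, 1, 2, 3, 4}" "Ide cospan_cat i = i"
  "e \<cdot>\<^bsub>cospan_cat\<^esub> d = (if e < 3 then d else e)" "d \<preceq>\<^bsub>cospan_cat\<^esub> e \<longleftrightarrow> d = e"
  by (auto simp: cospan_cat_def)

lemma pos_category_cospan: "pos_category cospan_cat"
proof
  fix f :: nat assume "f \<in> Arr cospan_cat"
  then show "Dom cospan_cat f \<in> Obj cospan_cat" "Cod cospan_cat f \<in> Obj cospan_cat"
    by (auto simp: cospan_cat_def)
next
  fix f g X Y Z assume "f \<in> hom cospan_cat X Y" "g \<in> hom cospan_cat Y Z"
  then show "g \<cdot>\<^bsub>cospan_cat\<^esub> f \<in> hom cospan_cat X Z"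
    by (auto simp: cospan_simps hom_cospan)
qed (auto simp: cospan_simps, auto simp: hom_cospan)

context regular_pos_category
begin

section \<open>Instances of finite weighted limits\<close>

lemma finite_weighted_limit:
  fixes D :: "(nat, nat) pos_cat" and Wo :: "nat \<Rightarrow> nat set"
  assumes "pos_category D" "finite (Obj D)" "finite (Arr D)" "pos_weight D Wo Wle Wa"
    "\<And>i. i \<in> Obj D \<Longrightarrow> finite (Wo i)" "pos_functor D C Fo Fa"
  obtains L \<kappa> where "is_weighted_limit D Wo Wle Wa C Fo Fa L \<kappa>"
  using finite_limits assms unfolding has_finite_weighted_limits_def by metis

lemma weighted_limit_lift:
  assumes "is_weighted_limit D Wo Wle Wa C Fo Fa L \<kappa>" "A \<in> Obj C"
    and "weighted_cylinder D Wo Wle Wa C Fo Fa A \<mu>"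
  obtains h where "h \<in> hom C A L" "\<forall>i \<in> Obj D. \<forall>w \<in> Wo i. \<kappa> i w \<cdot> h = \<mu> i w"
  using assms unfolding is_weighted_limit_def by blast

lemma weighted_limit_le:
  assumes "is_weighted_limit D Wo Wle Wa C Fo Fa L \<kappa>"
    and "u \<in> hom C A L" "v \<in> hom C A L"
    and "\<forall>i \<in> Obj D. \<forall>w \<in> Wo i. \<kappa> i w \<cdot> u \<preceq> \<kappa> i w \<cdot> v"
  shows "u \<preceq> v"
  using assms hom_dom_obj[OF assms(2)] unfolding is_weighted_limit_def by blast

text \<open>The limit of a discrete diagram on two objects, weighted by singletons, is a product: a
  cylinder amounts to two arrows with common domain.\<close>

lemma product_exists:
  assumes "X \<in> Obj C" "Y \<in> Obj C"
  shows "\<exists>P p q. is_product C X Y P p q"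
proof -
  define D where "D = discrete_cat {0, 1}"
  have homs: "d \<in> hom D i j \<longleftrightarrow> d = i \<and> j = i \<and> i \<in> {0, 1}" for d i j
    by (simp add: D_def hom_discrete)
  define Wo where "Wo = (\<lambda>i::nat. {0::nat})"
  define Wle where "Wle = (\<lambda>i::nat. (=) :: nat \<Rightarrow> nat \<Rightarrow> bool)"
  define Wa where "Wa = (\<lambda>(i::nat) (w::nat). w)"
  define Fo where "Fo = (\<lambda>i::nat. if i = 0 then X else Y)"
  define Fa where "Fa = (\<lambda>i. Ide C (Fo i))"
  note defs = Wo_def Wle_def Wa_def Fo_def Fa_def
  have Obj: "Obj D = {0, 1}" "Arr D = {0, 1}" "Ide D = (\<lambda>i. i)"
    "Comp D = (\<lambda>i j. i)" "Le D = (=)"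
    by (auto simp: D_def discrete_cat_def)
  note ideX = ide_hom[OF assms(1)] and ideY = ide_hom[OF assms(2)]
  obtain L \<kappa> where lim: "is_weighted_limit D Wo Wle Wa C Fo Fa L \<kappa>"
  proof (rule finite_weighted_limit[of D Wo Wle Wa Fo Fa])
    show "pos_category D" by (simp add: D_def pos_category_discrete)
    show "pos_weight D Wo Wle Wa"
      by unfold_locales (auto simp: homs Obj defs)
    show "pos_functor D C Fo Fa"
      using assms ideX ideY
      by unfold_locales (auto simp: homs Obj defs comp_ide_left[OF ideX] comp_ide_left[OF ideY]
          le_refl[OF ideX] le_refl[OF ideY])
  qed (auto simp: Obj Wo_def)
  have cyl: "weighted_cylinder D Wo Wle Wa C Fo Fa A \<mu> \<longleftrightarrow>
      \<mu> 0 0 \<in> hom C A X \<and> \<mu> 1 0 \<in> hom C A Y" for A \<mu>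
    by (auto simp: weighted_cylinder_def homs Obj defs comp_ide_left intro: le_refl)
  have \<kappa>: "L \<in> Obj C" "\<kappa> 0 0 \<in> hom C L X" "\<kappa> 1 0 \<in> hom C L Y"
    using lim by (auto simp: is_weighted_limit_def cyl)
  have "is_product C X Y L (\<kappa> 0 0) (\<kappa> 1 0)"
    unfolding is_product_def jointly_order_mono_def
  proof (intro conjI ballI impI)
    fix A u v assume "A \<in> Obj C" "u \<in> hom C A X" "v \<in> hom C A Y"
    moreover from this have
      "weighted_cylinder D Wo Wle Wa C Fo Fa A (\<lambda>i w. if i = 0 then u else v)"
      by (simp add: cyl)
    ultimately obtain h where "h \<in> hom C A L"
      "\<forall>i \<in> Obj D. \<forall>w \<in> Wo i. \<kappa> i w \<cdot> h = (if i = 0 then u else v)"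
      using weighted_limit_lift[OF lim] by blast
    then show "\<exists>h\<in>hom C A L. \<kappa> 0 0 \<cdot> h = u \<and> \<kappa> 1 0 \<cdot> h = v"
      by (auto simp: Obj Wo_def)
  qed (use \<kappa> in \<open>auto intro: weighted_limit_le[OF lim] simp: Obj Wo_def\<close>)
  then show ?thesis by blast
qed

text \<open>The limit of the cospan of \<open>f\<close> and \<open>g\<close>, weighted by
  singletons. A cylinder also has a leg into \<open>Z\<close>, but this leg is determined by either
  of the other two.\<close>

lemma pullback_exists:
  assumes f: "f \<in> hom C X Z" and g: "g \<in> hom C Y Z"
  obtains P p q where "is_pullback C f g P p q"
proof -
  define D where "D = cospan_cat"
  note homs = hom_cospan[folded D_def]
  define Wo where "Wo = (\<lambda>i::nat. {0::nat})"
  define Wle where "Wle = (\<lambda>i::nat. (=) :: nat \<Rightarrow> nat \<Rightarrow> bool)"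
  define Wa where "Wa = (\<lambda>(i::nat) (w::nat). w)"
  define Fo where "Fo = (\<lambda>i::nat. if i = 0 then X else if i = 1 then Y else Z)"
  define Fa where "Fa = (\<lambda>d. if d = 3 then f else if d = 4 then g else Ide C (Fo d))"
  note defs = Wo_def Wle_def Wa_def Fo_def Fa_def
  have Obj: "Obj D = {0, 1, 2}" "Arr D = {0, 1, 2, 3, 4}" "Ide D = (\<lambda>i. i)"
    "Comp D = (\<lambda>e d. if e < 3 then d else e)" "Le D = (=)"
    by (auto simp: D_def cospan_cat_def)
  have objs: "X \<in> Obj C" "Y \<in> Obj C" "Z \<in> Obj C"
    using f g hom_dom_obj hom_cod_obj by blast+
  note ides = objs[THEN ide_hom]
  obtain L \<kappa> where lim: "is_weighted_limit D Wo Wle Wa C Fo Fa L \<kappa>"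
  proof (rule finite_weighted_limit[of D Wo Wle Wa Fo Fa])
    show "pos_category D" by (simp add: D_def pos_category_cospan)
    show "pos_weight D Wo Wle Wa"
      by unfold_locales (auto simp: homs Obj defs)
    have ide: "Fo i \<in> Obj C" for i
      using objs by (simp add: Fo_def)
    have Fa: "Fa d \<in> hom C (Fo i) (Fo j)" if "d \<in> hom D i j" for d i j
      using that f g ides by (auto simp: homs defs)
    show "pos_functor D C Fo Fa"
    proof
      fix d e i j k assume d: "d \<in> hom D i j" and e: "e \<in> hom D j k"
      \<comment> \<open>No nonidentity arrow of the cospan ends where another begins, so one of
        \<open>d\<close> and \<open>e\<close> is an identity; the arrows below 3 are the
        identities.\<close>
      then consider "e = j" "e < 3" "k = j" | "d = i" "d < 3" "j = i" "\<not> e < 3"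
        by (auto simp: homs)
      then show "Fa (e \<cdot>\<^bsub>D\<^esub> d) = Fa e \<cdot> Fa d"
      proof cases
        case 1
        then have "Fa e = Ide C (Fo j)" by (auto simp: Fa_def)
        with 1 Fa[OF d] show ?thesis by (simp add: Obj comp_ide_left)
      next
        case 2
        then have "Fa d = Ide C (Fo j)" by (auto simp: Fa_def)
        with 2 Fa[OF e] show ?thesis by (simp add: Obj comp_ide_right)
      qed
    next
      fix d e i j assume "d \<in> hom D i j" "d \<preceq>\<^bsub>D\<^esub> e"
      then show "Fa d \<preceq> Fa e"
        using Fa le_refl by (simp add: Obj) blast
    qed (use ide Fa in \<open>auto simp: Fa_def Obj\<close>)
  qed (auto simp: Obj Wo_def)
  have cyl: "weighted_cylinder D Wo Wle Wa C Fo Fa A \<mu> \<longleftrightarrow>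
      \<mu> 0 0 \<in> hom C A X \<and> \<mu> 1 0 \<in> hom C A Y \<and> \<mu> 2 0 \<in> hom C A Z \<and>
      f \<cdot> \<mu> 0 0 = \<mu> 2 0 \<and> g \<cdot> \<mu> 1 0 = \<mu> 2 0" for A \<mu>
    by (auto simp: weighted_cylinder_def homs Obj defs comp_ide_left intro: le_refl)
  have \<kappa>: "L \<in> Obj C" "\<kappa> 0 0 \<in> hom C L X" "\<kappa> 1 0 \<in> hom C L Y" "\<kappa> 2 0 \<in> hom C L Z"
    "f \<cdot> \<kappa> 0 0 = \<kappa> 2 0" "g \<cdot> \<kappa> 1 0 = \<kappa> 2 0"
    using lim by (auto simp: is_weighted_limit_def cyl)
  have "is_pullback C f g L (\<kappa> 0 0) (\<kappa> 1 0)"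
    unfolding is_pullback_def jointly_order_mono_def homD[OF f] homD[OF g]
  proof (intro conjI ballI impI)
    fix A u v assume "A \<in> Obj C" "u \<in> hom C A X" "v \<in> hom C A Y" "f \<cdot> u = g \<cdot> v"
    moreover from this have "weighted_cylinder D Wo Wle Wa C Fo Fa A
        (\<lambda>i w. if i = 0 then u else if i = 1 then v else f \<cdot> u)"
      by (auto simp: cyl comp_hom[OF _ g])
    ultimately obtain h where "h \<in> hom C A L"
      "\<forall>i \<in> Obj D. \<forall>w \<in> Wo i. \<kappa> i w \<cdot> h = (if i = 0 then u else if i = 1 then v else f \<cdot> u)"
      using weighted_limit_lift[OF lim] by blast
    then show "\<exists>h\<in>hom C A L. \<kappa> 0 0 \<cdot> h = u \<and> \<kappa> 1 0 \<cdot> h = v"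
      by (auto simp: Obj Wo_def)
  next
    fix A u v assume A: "A \<in> Obj C" and u: "u \<in> hom C A L" and v: "v \<in> hom C A L"
      and le: "\<kappa> 0 0 \<cdot> u \<preceq> \<kappa> 0 0 \<cdot> v \<and> \<kappa> 1 0 \<cdot> u \<preceq> \<kappa> 1 0 \<cdot> v"
    \<comment> \<open>The limit separates arrows by three legs, a pullback only by two. The third
      leg is \<open>f\<close> after the first, so its inequality follows by monotonicity.\<close>
    have "\<kappa> 2 0 \<cdot> w = f \<cdot> (\<kappa> 0 0 \<cdot> w)" if "w \<in> hom C A L" for w
      using comp_assoc[OF that \<kappa>(2) f] \<kappa>(5) by simp
    then have "\<kappa> 2 0 \<cdot> u \<preceq> \<kappa> 2 0 \<cdot> v"
      using le u v comp_mono_left[OF comp_hom[OF u \<kappa>(2)] comp_hom[OF v \<kappa>(2)] f] by simp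
    then show "u \<preceq> v"
      using weighted_limit_le[OF lim u v] le by (auto simp: Obj Wo_def)
  qed (use \<kappa> homD[OF f] homD[OF g] in simp_all)
  then show thesis by (rule that)
qed

text \<open>The power of \<open>G\<close> by the two-element chain, with its two projections.\<close>

lemma comma_ide_exists:
  assumes G: "G \<in> Obj C"
  obtains K c\<^sub>0 c\<^sub>1 where "is_comma C (Ide C G) (Ide C G) K c\<^sub>0 c\<^sub>1"
proof -
  define D where "D = discrete_cat {0}"
  have homs: "d \<in> hom D i j \<longleftrightarrow> d = 0 \<and> j = 0 \<and> i = 0" for d i j
    by (auto simp add: D_def hom_discrete)
  define Wo where "Wo = (\<lambda>i::nat. {0::nat, 1})"
  define Wle where "Wle = (\<lambda>i::nat. (\<le>) :: nat \<Rightarrow> nat \<Rightarrow> bool)"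
  define Wa where "Wa = (\<lambda>(i::nat) (w::nat). w)"
  define Fo where "Fo = (\<lambda>i::nat. G)"
  define Fa where "Fa = (\<lambda>i::nat. Ide C G)"
  note defs = Wo_def Wle_def Wa_def Fo_def Fa_def
  have Obj: "Obj D = {0}" "Arr D = {0}" "Ide D = (\<lambda>i. i)" "Comp D = (\<lambda>i j. i)" "Le D = (=)"
    by (auto simp: D_def discrete_cat_def)
  note ide = ide_hom[OF G]
  obtain L \<kappa> where lim: "is_weighted_limit D Wo Wle Wa C Fo Fa L \<kappa>"
  proof (rule finite_weighted_limit[of D Wo Wle Wa Fo Fa])
    show "pos_category D" by (simp add: D_def pos_category_discrete)
    show "pos_weight D Wo Wle Wa"
      by unfold_locales (auto simp: homs Obj defs)
    show "pos_functor D C Fo Fa"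
      using G ide
      by unfold_locales (auto simp: homs Obj defs comp_ide_left[OF ide] le_refl[OF ide])
  qed (auto simp: Obj Wo_def)
  \<comment> \<open>The weight at the only object is the chain 0 \<le> 1, so its monotonicity
    condition turns a cylinder into an ordered pair of arrows to \<open>G\<close>.\<close>
  have cyl: "weighted_cylinder D Wo Wle Wa C Fo Fa A \<mu> \<longleftrightarrow>
      \<mu> 0 0 \<in> hom C A G \<and> \<mu> 0 1 \<in> hom C A G \<and> \<mu> 0 0 \<preceq> \<mu> 0 1" for A \<mu>
    by (auto simp: weighted_cylinder_def homs Obj defs comp_ide_left intro: le_refl)
  have \<kappa>: "L \<in> Obj C" "\<kappa> 0 0 \<in> hom C L G" "\<kappa> 0 1 \<in> hom C L G" "\<kappa> 0 0 \<preceq> \<kappa> 0 1"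
    using lim by (auto simp: is_weighted_limit_def cyl)
  have "is_comma C (Ide C G) (Ide C G) L (\<kappa> 0 0) (\<kappa> 0 1)"
    unfolding is_comma_def jointly_order_mono_def homD[OF ide]
  proof (intro conjI ballI impI)
    fix A u v assume "A \<in> Obj C" "u \<in> hom C A G" "v \<in> hom C A G" "Ide C G \<cdot> u \<preceq> Ide C G \<cdot> v"
    moreover from this have
      "weighted_cylinder D Wo Wle Wa C Fo Fa A (\<lambda>i w. if w = 0 then u else v)"
      by (simp add: cyl comp_ide_left)
    ultimately obtain h where "h \<in> hom C A L"
      "\<forall>i \<in> Obj D. \<forall>w \<in> Wo i. \<kappa> i w \<cdot> h = (if w = 0 then u else v)"
      using weighted_limit_lift[OF lim] by blast
    then show "\<exists>h\<in>hom C A L. \<kappa> 0 0 \<cdot> h = u \<and> \<kappa> 0 1 \<cdot> h = v"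
      by (auto simp: Obj Wo_def)
  next
    fix A u v assume "u \<in> hom C A L" "v \<in> hom C A L"
      "\<kappa> 0 0 \<cdot> u \<preceq> \<kappa> 0 0 \<cdot> v \<and> \<kappa> 0 1 \<cdot> u \<preceq> \<kappa> 0 1 \<cdot> v"
    then show "u \<preceq> v"
      using weighted_limit_le[OF lim, of u A v] by (simp add: Obj Wo_def)
  qed (use \<kappa> homD(1)[OF ide] in \<open>simp_all add: comp_ide_left\<close>)
  then show thesis by (rule that)
qed

section \<open>The chosen binary products and their pairings\<close>

lemma is_product_prod:
  assumes "X \<in> Obj C" "Y \<in> Obj C"
  shows "is_product C X Y (prod_obj C X Y) (proj\<^sub>0 C X Y) (proj\<^sub>1 C X Y)"
proof -
  have "case prod_cone C X Y of (P, p, q) \<Rightarrow> is_product C X Y P p q"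
    unfolding prod_cone_def by (rule someI_ex) (use product_exists[OF assms] in auto)
  then show ?thesis
    by (simp add: prod_obj_def proj\<^sub>0_def proj\<^sub>1_def case_prod_beta)
qed

lemma proj_hom:
  assumes "X \<in> Obj C" "Y \<in> Obj C"
  shows "proj\<^sub>0 C X Y \<in> hom C (prod_obj C X Y) X" "proj\<^sub>1 C X Y \<in> hom C (prod_obj C X Y) Y"
  using is_product_prod[OF assms] by (auto simp: is_product_def)

lemma prod_le:
  assumes "X \<in> Obj C" "Y \<in> Obj C"
    and "u \<in> hom C A (prod_obj C X Y)" "v \<in> hom C A (prod_obj C X Y)"
    and "proj\<^sub>0 C X Y \<cdot> u \<preceq> proj\<^sub>0 C X Y \<cdot> v" "proj\<^sub>1 C X Y \<cdot> u \<preceq> proj\<^sub>1 C X Y \<cdot> v"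
  shows "u \<preceq> v"
  using is_product_prod[OF assms(1,2)] assms(3-) hom_dom_obj[OF assms(3)]
  unfolding is_product_def jointly_order_mono_def by blast

lemma prod_eqI:
  assumes "X \<in> Obj C" "Y \<in> Obj C"
    and u: "u \<in> hom C A (prod_obj C X Y)" and v: "v \<in> hom C A (prod_obj C X Y)"
    and eq: "proj\<^sub>0 C X Y \<cdot> u = proj\<^sub>0 C X Y \<cdot> v" "proj\<^sub>1 C X Y \<cdot> u = proj\<^sub>1 C X Y \<cdot> v"
  shows "u = v"
proof -
  note p = proj_hom[OF assms(1,2)]
  have "proj\<^sub>0 C X Y \<cdot> v \<preceq> proj\<^sub>0 C X Y \<cdot> v" "proj\<^sub>1 C X Y \<cdot> v \<preceq> proj\<^sub>1 C X Y \<cdot> v"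
    using le_refl comp_hom[OF v] p by blast+
  then show ?thesis
    using le_antisym[OF u v] prod_le[OF assms(1,2)] u v eq by simp
qed

text \<open>The definite description is legitimate: the universal property gives an
  \<open>h\<close>, and joint order-monicity of the projections makes it unique.\<close>

lemma pairing:
  assumes x: "x \<in> hom C A X" and y: "y \<in> hom C A Y"
  shows "pairing C x y \<in> hom C A (prod_obj C X Y)"
    and "proj\<^sub>0 C X Y \<cdot> pairing C x y = x" "proj\<^sub>1 C X Y \<cdot> pairing C x y = y"
proof -
  note objs = hom_cod_obj[OF x] hom_cod_obj[OF y]
  obtain h where h: "h \<in> hom C A (prod_obj C X Y)" "proj\<^sub>0 C X Y \<cdot> h = x" "proj\<^sub>1 C X Y \<cdot> h = y"
    using is_product_prod[OF objs] x y hom_dom_obj[OF x] unfolding is_product_def by blast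
  have "pairing C x y = h"
    unfolding pairing_def homD[OF x] homD[OF y]
    by (rule the_equality) (use h prod_eqI[OF objs] in auto)
  with h show "pairing C x y \<in> hom C A (prod_obj C X Y)"
    "proj\<^sub>0 C X Y \<cdot> pairing C x y = x" "proj\<^sub>1 C X Y \<cdot> pairing C x y = y"
    by auto
qed

lemma pairing_unique:
  assumes "X \<in> Obj C" "Y \<in> Obj C" and h: "h \<in> hom C A (prod_obj C X Y)"
  shows "pairing C (proj\<^sub>0 C X Y \<cdot> h) (proj\<^sub>1 C X Y \<cdot> h) = h"
proof -
  note p = pairing[OF comp_hom[OF h proj_hom(1)[OF assms(1,2)]]
      comp_hom[OF h proj_hom(2)[OF assms(1,2)]]]
  show ?thesis
    by (rule prod_eqI[OF assms(1,2) p(1) h p(2,3)])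
qed

lemma pairing_comp:
  assumes x: "x \<in> hom C A X" and y: "y \<in> hom C A Y" and u: "u \<in> hom C B A"
  shows "pairing C x y \<cdot> u = pairing C (x \<cdot> u) (y \<cdot> u)"
proof -
  note objs = hom_cod_obj[OF x] hom_cod_obj[OF y]
  note p = pairing[OF x y]
  have "proj\<^sub>0 C X Y \<cdot> (pairing C x y \<cdot> u) = x \<cdot> u" "proj\<^sub>1 C X Y \<cdot> (pairing C x y \<cdot> u) = y \<cdot> u"
    using comp_assoc[OF u p(1) proj_hom(1)[OF objs]] comp_assoc[OF u p(1) proj_hom(2)[OF objs]]
      p(2,3) by simp_all
  then show ?thesis
    using pairing_unique[OF objs comp_hom[OF u p(1)]] by simp
qed

text \<open>Since the product projections are monotone and jointly reflect the order, comparing two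
  composites with the pairing means comparing both components. This translates between comma objects
  and representatives of subobjects.\<close>

lemma jointly_order_mono_iff_ff_pairing:
  assumes p: "p \<in> hom C K X" and q: "q \<in> hom C K Y"
  shows "jointly_order_mono C K p q \<longleftrightarrow> ff_mor C (pairing C p q)"
proof -
  note objs = hom_cod_obj[OF p] hom_cod_obj[OF q]
  note pq = pairing[OF p q]
  have "pairing C p q \<cdot> u \<preceq> pairing C p q \<cdot> v \<longleftrightarrow> p \<cdot> u \<preceq> p \<cdot> v \<and> q \<cdot> u \<preceq> q \<cdot> v"
    if uv: "u \<in> hom C A K" "v \<in> hom C A K" for A u v
  proof -
    note pu = pairing[OF comp_hom[OF uv(1) p] comp_hom[OF uv(1) q]]
    note pv = pairing[OF comp_hom[OF uv(2) p] comp_hom[OF uv(2) q]]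
    have "pairing C (p \<cdot> u) (q \<cdot> u) \<preceq> pairing C (p \<cdot> v) (q \<cdot> v) \<longleftrightarrow> p \<cdot> u \<preceq> p \<cdot> v \<and> q \<cdot> u \<preceq> q \<cdot> v"
      using prod_le[OF objs pu(1) pv(1), unfolded pu(2,3) pv(2,3)]
        comp_mono_left[OF pu(1) pv(1) proj_hom(1)[OF objs], unfolded pu(2) pv(2)]
        comp_mono_left[OF pu(1) pv(1) proj_hom(2)[OF objs], unfolded pu(3) pv(3)] by blast
    then show ?thesis
      by (simp only: pairing_comp[OF p q uv(1)] pairing_comp[OF p q uv(2)])
  qed
  then show ?thesis
    using homD[OF pq(1)] by (auto simp: jointly_order_mono_def ff_mor_def)
qed

lemma jointly_order_mono_le:
  assumes "jointly_order_mono C K p q" "u \<in> hom C A K" "v \<in> hom C A K"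
    and "p \<cdot> u \<preceq> p \<cdot> v" "q \<cdot> u \<preceq> q \<cdot> v"
  shows "u \<preceq> v"
  using assms hom_dom_obj[OF assms(2)] by (auto simp: jointly_order_mono_def)

lemma comma_lift:
  assumes "is_comma C f g K c\<^sub>0 c\<^sub>1" and f: "f \<in> hom C X Z" and g: "g \<in> hom C Y Z"
    and x: "x \<in> hom C A X" and y: "y \<in> hom C A Y" and le: "f \<cdot> x \<preceq> g \<cdot> y"
  obtains h where "h \<in> hom C A K" "c\<^sub>0 \<cdot> h = x" "c\<^sub>1 \<cdot> h = y"
  using assms(1) x y le hom_dom_obj[OF x] that unfolding is_comma_def homD[OF f] homD[OF g] by blast

lemma pullback_lift:
  assumes "is_pullback C f g P p q" and f: "f \<in> hom C X Z" and g: "g \<in> hom C Y Z"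
    and x: "x \<in> hom C A X" and y: "y \<in> hom C A Y" and eq: "f \<cdot> x = g \<cdot> y"
  obtains h where "h \<in> hom C A P" "p \<cdot> h = x" "q \<cdot> h = y"
  using assms(1) x y eq hom_dom_obj[OF x] that unfolding is_pullback_def homD[OF f] homD[OF g] by blast

text \<open>
  The pair of \<open>a\<close> and \<open>b\<close> factors through the order of \<open>G\<close>, an \<open>ff\<close>-morphism, after composing
  with \<open>e\<close>; hence it does so before.
\<close>

lemma so_order_epi:
  assumes e: "so_mor C e" "e \<in> hom C A B" and a: "a \<in> hom C B G" and b: "b \<in> hom C B G"
    and le: "a \<cdot> e \<preceq> b \<cdot> e"
  shows "a \<preceq> b"
proof -
  note G = hom_cod_obj[OF a]
  note ide = ide_hom[OF G]
  obtain K c\<^sub>0 c\<^sub>1 where K: "is_comma C (Ide C G) (Ide C G) K c\<^sub>0 c\<^sub>1"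
    by (rule comma_ide_exists[OF G])
  then have c: "c\<^sub>0 \<in> hom C K G" "c\<^sub>1 \<in> hom C K G" "c\<^sub>0 \<preceq> c\<^sub>1" "ff_mor C (pairing C c\<^sub>0 c\<^sub>1)"
    using jointly_order_mono_iff_ff_pairing
    by (auto simp: is_comma_def homD[OF ide] comp_ide_left)
  have ae: "a \<cdot> e \<in> hom C A G" and be: "b \<cdot> e \<in> hom C A G"
    using comp_hom e a b by blast+
  with le obtain u where u: "u \<in> hom C A K" "c\<^sub>0 \<cdot> u = a \<cdot> e" "c\<^sub>1 \<cdot> u = b \<cdot> e"
    using comma_lift[OF K ide ide ae be] by (auto simp: comp_ide_left[OF ae] comp_ide_left[OF be])
  have "pairing C c\<^sub>0 c\<^sub>1 \<cdot> u = pairing C a b \<cdot> e"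
    using pairing_comp[OF c(1,2) u(1)] pairing_comp[OF a b e(2)] u(2,3) by simp
  then obtain d where d: "d \<in> hom C B K" "pairing C c\<^sub>0 c\<^sub>1 \<cdot> d = pairing C a b"
    using so_diagonal[OF e c(4) pairing(1)[OF c(1,2)] u(1) pairing(1)[OF a b]] by blast
  then have "c\<^sub>0 \<cdot> d = a" "c\<^sub>1 \<cdot> d = b"
    using pairing_comp[OF c(1,2) d(1)] pairing(2,3)[OF a b]
      pairing(2,3)[OF comp_hom[OF d(1) c(1)] comp_hom[OF d(1) c(2)]] by simp_all
  \<comment> \<open>Restricting \<open>c\<^sub>0 \<preceq> c\<^sub>1\<close> along the diagonal
    \<open>d\<close> yields the inequality between \<open>a\<close> and \<open>b\<close>.\<close>
  then show ?thesis
    using comp_mono_right[OF c(1,2) d(1) c(3)] by simp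
qed

text \<open>An arrow into the codomain of \<open>e\<close> need not lift through \<open>e\<close>,
  but it does after restriction along the pullback \<open>k\<close> of \<open>e\<close>, which is
  again an \<open>so\<close>-morphism. This replaces the choice of preimages.\<close>

lemma so_pullback:
  assumes e: "so_mor C e" "e \<in> hom C A B" and a: "a \<in> hom C Z B"
  obtains W k u where "so_mor C k" "k \<in> hom C W Z" "u \<in> hom C W A" "a \<cdot> k = e \<cdot> u"
proof -
  obtain W k u where W: "is_pullback C a e W k u"
    by (rule pullback_exists[OF a e(2)])
  then have "so_mor C k" using so_stable e(1) by blast
  with W show thesis
    using that by (auto simp: is_pullback_def homD[OF a] homD[OF e(2)])
qed

section \<open>Membership in relations\<close>

lemma rel_legs:
  assumes "X \<in> Obj C" "Y \<in> Obj C" "r \<in> hom C D (prod_obj C X Y)"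
  shows "proj\<^sub>0 C X Y \<cdot> r \<in> hom C D X" "proj\<^sub>1 C X Y \<cdot> r \<in> hom C D Y"
  using comp_hom[OF assms(3)] proj_hom[OF assms(1,2)] by auto

lemma pairing_factors_iff:
  assumes r: "r \<in> hom C D (prod_obj C X Y)"
    and x: "x \<in> hom C A X" and y: "y \<in> hom C A Y"
  shows "factors_through C (pairing C x y) r \<longleftrightarrow>
    (\<exists>h \<in> hom C A D. (proj\<^sub>0 C X Y \<cdot> r) \<cdot> h = x \<and> (proj\<^sub>1 C X Y \<cdot> r) \<cdot> h = y)"
proof -
  note objs = hom_cod_obj[OF x] hom_cod_obj[OF y]
  note legs = rel_legs[OF objs r]
  note xy = pairing[OF x y]
  have "pairing C x y = r \<cdot> h \<longleftrightarrow> (proj\<^sub>0 C X Y \<cdot> r) \<cdot> h = x \<and> (proj\<^sub>1 C X Y \<cdot> r) \<cdot> h = y"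
    if h: "h \<in> hom C A D" for h
  proof -
    have "r \<cdot> h = pairing C ((proj\<^sub>0 C X Y \<cdot> r) \<cdot> h) ((proj\<^sub>1 C X Y \<cdot> r) \<cdot> h)"
      using pairing_comp[OF legs h] pairing_unique[OF objs r] by simp
    then show ?thesis
      using pairing(2,3)[OF comp_hom[OF h legs(1)] comp_hom[OF h legs(2)]] xy(2,3) by auto
  qed
  then show ?thesis
    by (auto simp: factors_through_iff[OF xy(1) r])
qed

text \<open>Membership may be tested on any one representative, because all representatives of a
  subobject factor through each other.\<close>

lemma in_rel_iff:
  assumes R: "R \<in> subobjects C (prod_obj C X Y)" "r \<in> R"
    and x: "x \<in> hom C A X" and y: "y \<in> hom C A Y"
  shows "in_rel C x y R \<longleftrightarrow> factors_through C (pairing C x y) r"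
proof
  assume "in_rel C x y R"
  then obtain m where "m \<in> R" "factors_through C (pairing C x y) m"
    by (auto simp: in_rel_def)
  then show "factors_through C (pairing C x y) r"
    using factors_through_trans[OF pairing(1)[OF x y]] subobject_ff(2)[OF R(1)]
      subobject_factors[OF R(1)] R(2) by blast
qed (use R(2) in \<open>auto simp: in_rel_def\<close>)

lemma in_rel_comp:
  assumes R: "R \<in> subobjects C (prod_obj C X Y)"
    and x: "x \<in> hom C A X" and y: "y \<in> hom C A Y" and u: "u \<in> hom C B A"
    and xy: "in_rel C x y R"
  shows "in_rel C (x \<cdot> u) (y \<cdot> u) R"
proof -
  obtain r where r: "r \<in> R" by (rule subobject_rep[OF R])
  have "factors_through C (pairing C x y \<cdot> u) (pairing C x y)"
    using factors_through_iff comp_hom pairing(1)[OF x y] u by blast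
  then have "factors_through C (pairing C x y \<cdot> u) r"
    using factors_through_trans in_rel_iff[OF R r x y] xy subobject_ff(2)[OF R r]
      comp_hom[OF u pairing(1)[OF x y]] pairing(1)[OF x y] by blast
  then show ?thesis
    using pairing_comp[OF x y u] r by (auto simp: in_rel_def)
qed

text \<open>The factorization of the restricted pair gives a square from \<open>e\<close> to the
  \<open>ff\<close>-morphism \<open>r\<close>, and its diagonal factors the original pair.
  Membership is thus local with respect to \<open>so\<close>-covers.\<close>

lemma in_rel_so_descent:
  assumes R: "R \<in> subobjects C (prod_obj C X Y)" and e: "so_mor C e" "e \<in> hom C B A"
    and x: "x \<in> hom C A X" and y: "y \<in> hom C A Y"
    and xy: "in_rel C (x \<cdot> e) (y \<cdot> e) R"
  shows "in_rel C x y R"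
proof -
  obtain r where r: "r \<in> R" by (rule subobject_rep[OF R])
  note rh = subobject_ff[OF R r]
  note p = pairing(1)[OF x y]
  have "factors_through C (pairing C x y \<cdot> e) r"
    using xy in_rel_iff[OF R r comp_hom[OF e(2) x] comp_hom[OF e(2) y]]
      pairing_comp[OF x y e(2)] by simp
  then obtain h where "h \<in> hom C B (Dom C r)" "pairing C x y \<cdot> e = r \<cdot> h"
    using factors_through_iff[OF comp_hom[OF e(2) p] rh(2)] by blast
  then obtain d where "d \<in> hom C A (Dom C r)" "pairing C x y = r \<cdot> d"
    using so_diagonal[OF e rh _ p] by metis
  then have "factors_through C (pairing C x y) r"
    using factors_through_iff[OF p rh(2)] by auto
  then show ?thesis using r by (auto simp: in_rel_def)
qed

section \<open>Composites of relations in terms of generalized elements\<close>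

lemma so_ff_factorization_hom:
  assumes "so_ff_factorization C f e m" "f \<in> hom C A B"
  shows "so_mor C e" "ff_mor C m" "e \<in> hom C A (Dom C m)" "m \<in> hom C (Dom C m) B" "f = m \<cdot> e"
proof -
  show *: "so_mor C e" "ff_mor C m" "f = m \<cdot> e"
    using assms by (auto simp: so_ff_factorization_def)
  have e: "e \<in> hom C (Dom C e) (Dom C m)" and m: "m \<in> hom C (Dom C m) (Cod C m)"
    using assms(1) by (auto simp: so_ff_factorization_def so_mor_def ff_mor_def hom_def)
  have "Dom C e = A" "Cod C m = B"
    using homD(2,3)[OF comp_hom[OF e m]] homD(2,3)[OF assms(2)] *(3) by auto
  with e m show "e \<in> hom C A (Dom C m)" "m \<in> hom C (Dom C m) B"
    by simp_all
qed

lemma rel_comp_legs: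
  assumes S: "S \<in> subobjects C (prod_obj C Y Z)" and R: "R \<in> subobjects C (prod_obj C X Y)"
    and objs: "X \<in> Obj C" "Y \<in> Obj C" "Z \<in> Obj C"
    and n: "n \<in> rel_comp C X Y Z S R"
  obtains r s T t\<^sub>0 t\<^sub>1 e where "r \<in> R" "s \<in> S"
    "is_pullback C (proj\<^sub>1 C X Y \<cdot> r) (proj\<^sub>0 C Y Z \<cdot> s) T t\<^sub>0 t\<^sub>1"
    "t\<^sub>0 \<in> hom C T (Dom C r)" "t\<^sub>1 \<in> hom C T (Dom C s)"
    "so_mor C e" "ff_mor C n" "e \<in> hom C T (Dom C n)" "n \<in> hom C (Dom C n) (prod_obj C X Z)"
    "pairing C ((proj\<^sub>0 C X Y \<cdot> r) \<cdot> t\<^sub>0) ((proj\<^sub>1 C Y Z \<cdot> s) \<cdot> t\<^sub>1) = n \<cdot> e"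
proof -
  obtain r s T t\<^sub>0 t\<^sub>1 e where rs: "r \<in> R" "s \<in> S"
    and T: "is_pullback C (proj\<^sub>1 C X Y \<cdot> r) (proj\<^sub>0 C Y Z \<cdot> s) T t\<^sub>0 t\<^sub>1"
    and f: "so_ff_factorization C
      (pairing C ((proj\<^sub>0 C X Y \<cdot> r) \<cdot> t\<^sub>0) ((proj\<^sub>1 C Y Z \<cdot> s) \<cdot> t\<^sub>1)) e n"
    using n unfolding rel_comp_def by blast
  note r = rel_legs[OF objs(1,2) subobject_ff(2)[OF R rs(1)]]
  note s = rel_legs[OF objs(2,3) subobject_ff(2)[OF S rs(2)]]
  have t: "t\<^sub>0 \<in> hom C T (Dom C r)" "t\<^sub>1 \<in> hom C T (Dom C s)"
    using T r s by (auto simp: is_pullback_def homD)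
  note fh = so_ff_factorization_hom[OF f pairing(1)[OF comp_hom[OF t(1) r(1)] comp_hom[OF t(2) s(2)]]]
  show thesis
    by (rule that[OF rs T t fh])
qed

text \<open>The lifts of the two pairs to \<open>r\<close> and \<open>s\<close> agree over
  \<open>Y\<close>, so they induce an arrow into the pullback \<open>T\<close>, and hence one into
  the image. Stating this for an arbitrary member \<open>n\<close> avoids comparing different
  choices of pullback and factorization.\<close>

lemma rel_comp_intro:
  assumes S: "S \<in> subobjects C (prod_obj C Y Z)" and R: "R \<in> subobjects C (prod_obj C X Y)"
    and x: "x \<in> hom C A X" and y: "y \<in> hom C A Y" and z: "z \<in> hom C A Z"
    and xy: "in_rel C x y R" and yz: "in_rel C y z S"
    and n: "n \<in> rel_comp C X Y Z S R"
  shows "factors_through C (pairing C x z) n"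
proof -
  note objs = hom_cod_obj[OF x] hom_cod_obj[OF y] hom_cod_obj[OF z]
  obtain r s T t\<^sub>0 t\<^sub>1 e where rs: "r \<in> R" "s \<in> S"
    and T: "is_pullback C (proj\<^sub>1 C X Y \<cdot> r) (proj\<^sub>0 C Y Z \<cdot> s) T t\<^sub>0 t\<^sub>1"
    and t: "t\<^sub>0 \<in> hom C T (Dom C r)" "t\<^sub>1 \<in> hom C T (Dom C s)"
    and e: "so_mor C e" "ff_mor C n" "e \<in> hom C T (Dom C n)" "n \<in> hom C (Dom C n) (prod_obj C X Z)"
    and eq: "pairing C ((proj\<^sub>0 C X Y \<cdot> r) \<cdot> t\<^sub>0) ((proj\<^sub>1 C Y Z \<cdot> s) \<cdot> t\<^sub>1) = n \<cdot> e"
    by (rule rel_comp_legs[OF S R objs n])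
  note r = rel_legs[OF objs(1,2) subobject_ff(2)[OF R rs(1)]]
  note s = rel_legs[OF objs(2,3) subobject_ff(2)[OF S rs(2)]]
  obtain h where h: "h \<in> hom C A (Dom C r)" "(proj\<^sub>0 C X Y \<cdot> r) \<cdot> h = x" "(proj\<^sub>1 C X Y \<cdot> r) \<cdot> h = y"
    using xy in_rel_iff[OF R rs(1) x y] pairing_factors_iff[OF subobject_ff(2)[OF R rs(1)] x y]
    by blast
  obtain k where k: "k \<in> hom C A (Dom C s)" "(proj\<^sub>0 C Y Z \<cdot> s) \<cdot> k = y" "(proj\<^sub>1 C Y Z \<cdot> s) \<cdot> k = z"
    using yz in_rel_iff[OF S rs(2) y z] pairing_factors_iff[OF subobject_ff(2)[OF S rs(2)] y z]
    by blast
  obtain w where w: "w \<in> hom C A T" "t\<^sub>0 \<cdot> w = h" "t\<^sub>1 \<cdot> w = k"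
    using pullback_lift[OF T r(2) s(1) h(1) k(1)] h(3) k(2) by auto
  have "pairing C x z = (n \<cdot> e) \<cdot> w"
    using eq pairing_comp[OF comp_hom[OF t(1) r(1)] comp_hom[OF t(2) s(2)] w(1)]
      comp_assoc[OF w(1) t(1) r(1)] comp_assoc[OF w(1) t(2) s(2)] h k w by simp
  then show ?thesis
    using comp_assoc[OF w(1) e(3,4)] comp_hom[OF w(1) e(3)]
      factors_through_iff[OF pairing(1)[OF x z] e(4)] by auto
qed

text \<open>The intermediate element \<open>y\<close> lives on the pullback \<open>T\<close>, which
  merely covers the image by the \<open>so\<close>-morphism \<open>e\<close>. It is therefore
  obtained only after restriction along some \<open>so\<close>-morphism \<open>k\<close>.\<close>

lemma rel_comp_elim:
  assumes S: "S \<in> subobjects C (prod_obj C Y Z)" and R: "R \<in> subobjects C (prod_obj C X Y)"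
    and x: "x \<in> hom C A X" and z: "z \<in> hom C A Z" and Y: "Y \<in> Obj C"
    and n: "n \<in> rel_comp C X Y Z S R" and xz: "factors_through C (pairing C x z) n"
  obtains B k y where "so_mor C k" "k \<in> hom C B A" "y \<in> hom C B Y"
    "in_rel C (x \<cdot> k) y R" "in_rel C y (z \<cdot> k) S"
proof -
  note objs = hom_cod_obj[OF x] Y hom_cod_obj[OF z]
  obtain r s T t\<^sub>0 t\<^sub>1 e where rs: "r \<in> R" "s \<in> S"
    and T: "is_pullback C (proj\<^sub>1 C X Y \<cdot> r) (proj\<^sub>0 C Y Z \<cdot> s) T t\<^sub>0 t\<^sub>1"
    and t: "t\<^sub>0 \<in> hom C T (Dom C r)" "t\<^sub>1 \<in> hom C T (Dom C s)"
    and e: "so_mor C e" "ff_mor C n" "e \<in> hom C T (Dom C n)" "n \<in> hom C (Dom C n) (prod_obj C X Z)"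
    and eq: "pairing C ((proj\<^sub>0 C X Y \<cdot> r) \<cdot> t\<^sub>0) ((proj\<^sub>1 C Y Z \<cdot> s) \<cdot> t\<^sub>1) = n \<cdot> e"
    by (rule rel_comp_legs[OF S R objs n])
  note r = rel_legs[OF objs(1,2) subobject_ff(2)[OF R rs(1)]]
  note s = rel_legs[OF objs(2,3) subobject_ff(2)[OF S rs(2)]]
  let ?x = "(proj\<^sub>0 C X Y \<cdot> r) \<cdot> t\<^sub>0" and ?y = "(proj\<^sub>1 C X Y \<cdot> r) \<cdot> t\<^sub>0" and ?z = "(proj\<^sub>1 C Y Z \<cdot> s) \<cdot> t\<^sub>1"
  have xh: "?x \<in> hom C T X" and yh: "?y \<in> hom C T Y" and zh: "?z \<in> hom C T Z"
    using comp_hom t r s by blast+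
  \<comment> \<open>The pullback square commutes, so the element of \<open>Y\<close> seen from
    \<open>r\<close> is the one seen from \<open>s\<close>.\<close>
  have y_eq: "?y = (proj\<^sub>0 C Y Z \<cdot> s) \<cdot> t\<^sub>1"
    using T by (simp add: is_pullback_def)
  have xy: "in_rel C ?x ?y R"
    using in_rel_iff[OF R rs(1) xh yh] pairing_factors_iff[OF subobject_ff(2)[OF R rs(1)] xh yh] t(1)
    by blast
  have yz: "in_rel C ?y ?z S"
    using in_rel_iff[OF S rs(2) yh zh] pairing_factors_iff[OF subobject_ff(2)[OF S rs(2)] yh zh] t(2)
      y_eq by metis
  obtain h where h: "h \<in> hom C A (Dom C n)" "pairing C x z = n \<cdot> h"
    using xz factors_through_iff[OF pairing(1)[OF x z] e(4)] by blast
  \<comment> \<open>Lift the element \<open>h\<close> of the image to the pullback \<open>T\<close>,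
    locally along \<open>k\<close>.\<close>
  obtain B k u where B: "so_mor C k" "k \<in> hom C B A" "u \<in> hom C B T" "h \<cdot> k = e \<cdot> u"
    by (rule so_pullback[OF e(1,3) h(1)])
  have "pairing C (x \<cdot> k) (z \<cdot> k) = pairing C (?x \<cdot> u) (?z \<cdot> u)"
    using pairing_comp[OF x z B(2)] pairing_comp[OF xh zh B(3)] eq h
      comp_assoc[OF B(2) h(1) e(4)] comp_assoc[OF B(3) e(3,4)] B(4) by simp
  then have "x \<cdot> k = ?x \<cdot> u" "z \<cdot> k = ?z \<cdot> u"
    using pairing(2,3)[OF comp_hom[OF B(2) x] comp_hom[OF B(2) z]]
      pairing(2,3)[OF comp_hom[OF B(3) xh] comp_hom[OF B(3) zh]] by simp_all
  then show thesis
    using that[OF B(1,2) comp_hom[OF B(3) yh]] in_rel_comp[OF R xh yh B(3) xy]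
      in_rel_comp[OF S yh zh B(3) yz] by simp
qed

section \<open>Relations given by comma objects\<close>

lemma pairing_comma_factors_iff:
  assumes K: "is_comma C f g K c\<^sub>0 c\<^sub>1" and f: "f \<in> hom C X Z" and g: "g \<in> hom C Y Z"
    and x: "x \<in> hom C A X" and y: "y \<in> hom C A Y"
  shows "factors_through C (pairing C x y) (pairing C c\<^sub>0 c\<^sub>1) \<longleftrightarrow> f \<cdot> x \<preceq> g \<cdot> y"
proof -
  have c: "c\<^sub>0 \<in> hom C K X" "c\<^sub>1 \<in> hom C K Y" "f \<cdot> c\<^sub>0 \<preceq> g \<cdot> c\<^sub>1"
    using K by (auto simp: is_comma_def homD[OF f] homD[OF g])
  note p = pairing[OF c(1,2)]
  \<comment> \<open>For one direction, the inequality of the comma square is restricted along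
    \<open>h\<close>; the other is the universal property.\<close>
  have "f \<cdot> (c\<^sub>0 \<cdot> h) \<preceq> g \<cdot> (c\<^sub>1 \<cdot> h)" if h: "h \<in> hom C A K" for h
    using comp_mono_right[OF comp_hom[OF c(1) f] comp_hom[OF c(2) g] h c(3)]
      comp_assoc[OF h c(1) f] comp_assoc[OF h c(2) g] by simp
  moreover have "\<exists>h \<in> hom C A K. c\<^sub>0 \<cdot> h = x \<and> c\<^sub>1 \<cdot> h = y" if "f \<cdot> x \<preceq> g \<cdot> y"
    using comma_lift[OF K f g x y that] by blast
  ultimately show ?thesis
    using pairing_factors_iff[OF p(1) x y] p by auto
qed

section \<open>Maps from adjunctions\<close>

text \<open>The adjunction enters only through generalized elements: \<open>e\<close> and
  \<open>y\<close> are what the unit gives locally for the identity of \<open>X\<close>, and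
  \<open>counit\<close> is the inclusion of \<phi>\<psi> in the order of \<open>Y\<close>.\<close>

lemma graph_of_adjoint:
  assumes R: "R \<in> subobjects C (prod_obj C X Y)" and S: "S \<in> subobjects C (prod_obj C Y X)"
    and w: "weakening_closed C X Y R"
    and e: "so_mor C e" "e \<in> hom C A X" and y: "y \<in> hom C A Y"
    and eyR: "in_rel C e y R" and eyS: "in_rel C y e S"
    and counit: "\<And>B v u v'. \<lbrakk>v \<in> hom C B Y; u \<in> hom C B X; v' \<in> hom C B Y;
      in_rel C v u S; in_rel C u v' R\<rbrakk> \<Longrightarrow> v \<preceq> v'"
  obtains f where "f \<in> hom C X Y"
    and "\<And>B u v. \<lbrakk>u \<in> hom C B X; v \<in> hom C B Y\<rbrakk> \<Longrightarrow> in_rel C u v R \<longleftrightarrow> f \<cdot> u \<preceq> v"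
proof -
  note objs = hom_cod_obj[OF e(2)] hom_cod_obj[OF y]
  have y_mono: "y \<cdot> u \<preceq> y \<cdot> v"
    if u: "u \<in> hom C B A" and v: "v \<in> hom C B A" and le: "e \<cdot> u \<preceq> e \<cdot> v" for B u v
  proof -
    note hs = comp_hom[OF u e(2)] comp_hom[OF v e(2)] comp_hom[OF u y] comp_hom[OF v y]
    \<comment> \<open>Restrict \<open>eyR\<close> along \<open>v\<close> and lower the first
      component from \<open>e \<cdot> v\<close> to \<open>e \<cdot> u\<close>. Now
      \<open>y \<cdot> u\<close> is related by \<open>S\<close> to \<open>e \<cdot> u\<close>, which
      is related by \<open>R\<close> to \<open>y \<cdot> v\<close>, and the counit applies.\<close>
    have "in_rel C (e \<cdot> u) (y \<cdot> v) R"
      using w le in_rel_comp[OF R e(2) y v eyR] le_refl[OF hs(4)] hs hom_dom_obj[OF u]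
      unfolding weakening_closed_def by blast
    then show ?thesis
      using counit[OF hs(3,1,4)] in_rel_comp[OF S y e(2) u eyS] by blast
  qed
  note ey = pairing[OF e(2) y]
  \<comment> \<open>The image of the pair of \<open>e\<close> and \<open>y\<close> is meant to be
    the graph of the desired arrow, with legs \<open>g\<close> to \<open>X\<close> and
    \<open>h\<close> to \<open>Y\<close>.\<close>
  obtain q n where fac: "so_ff_factorization C (pairing C e y) q n"
    using factorization homD(1)[OF ey(1)] by blast
  define G where "G = Dom C n"
  define g where "g = proj\<^sub>0 C X Y \<cdot> n"
  define h where "h = proj\<^sub>1 C X Y \<cdot> n"
  note fac' = so_ff_factorization_hom[OF fac ey(1), folded G_def]
  have g: "g \<in> hom C G X" and h: "h \<in> hom C G Y"
    using rel_legs[OF objs fac'(4)] by (auto simp: g_def h_def)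
  have n: "n = pairing C g h"
    using pairing_unique[OF objs fac'(4)] by (simp add: g_def h_def)
  have gq: "g \<cdot> q = e" and hq: "h \<cdot> q = y"
    using comp_assoc[OF fac'(3,4) proj_hom(1)[OF objs]] comp_assoc[OF fac'(3,4) proj_hom(2)[OF objs]]
      ey(2,3) fac'(5) by (auto simp: g_def h_def)
  \<comment> \<open>Elements of \<open>G\<close> come from \<open>A\<close> only locally. Two
    successive covers, \<open>k\<close> for \<open>a\<close> and \<open>l\<close> for
    \<open>b\<close>, give lifts \<open>u \<cdot> l\<close> and \<open>v\<close> on the common
    domain \<open>W\<close>, where \<open>y_mono\<close> can be used.\<close>
  have "a \<preceq> b" if a: "a \<in> hom C Z G" and b: "b \<in> hom C Z G" and le: "g \<cdot> a \<preceq> g \<cdot> b" for Z a b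
  proof -
    obtain V k u where k: "so_mor C k" "k \<in> hom C V Z" "u \<in> hom C V A" "a \<cdot> k = q \<cdot> u"
      by (rule so_pullback[OF fac'(1,3) a])
    obtain W l v where l: "so_mor C l" "l \<in> hom C W V" "v \<in> hom C W A" "(b \<cdot> k) \<cdot> l = q \<cdot> v"
      by (rule so_pullback[OF fac'(1,3) comp_hom[OF k(2) b]])
    note ak = comp_hom[OF k(2) a] and bk = comp_hom[OF k(2) b]
    note akl = comp_hom[OF l(2) ak] and bkl = comp_hom[OF l(2) bk]
    note ul = comp_hom[OF l(2) k(3)]
    have aq: "(a \<cdot> k) \<cdot> l = q \<cdot> (u \<cdot> l)"
      using comp_assoc[OF l(2) k(3) fac'(3)] k(4) by simp
    have "(g \<cdot> a) \<cdot> (k \<cdot> l) \<preceq> (g \<cdot> b) \<cdot> (k \<cdot> l)"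
      by (rule comp_mono_right[OF comp_hom[OF a g] comp_hom[OF b g] comp_hom[OF l(2) k(2)] le])
    then have gle: "g \<cdot> ((a \<cdot> k) \<cdot> l) \<preceq> g \<cdot> ((b \<cdot> k) \<cdot> l)"
      using comp_assoc[OF comp_hom[OF l(2) k(2)] a g] comp_assoc[OF comp_hom[OF l(2) k(2)] b g]
        comp_assoc[OF l(2) k(2) a] comp_assoc[OF l(2) k(2) b] by simp
    then have "e \<cdot> (u \<cdot> l) \<preceq> e \<cdot> v"
      using aq l(4) comp_assoc[OF ul fac'(3) g] comp_assoc[OF l(3) fac'(3) g] gq by simp
    then have "y \<cdot> (u \<cdot> l) \<preceq> y \<cdot> v"
      by (rule y_mono[OF ul l(3)])
    then have hle: "h \<cdot> ((a \<cdot> k) \<cdot> l) \<preceq> h \<cdot> ((b \<cdot> k) \<cdot> l)"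
      using aq l(4) comp_assoc[OF ul fac'(3) h] comp_assoc[OF l(3) fac'(3) h] hq by simp
    \<comment> \<open>On \<open>W\<close> both legs now compare in the right direction, and
      \<open>n\<close> is an \<open>ff\<close>-morphism; the inequality then descends along
      \<open>l\<close> and next along \<open>k\<close>.\<close>
    have "jointly_order_mono C G g h"
      using jointly_order_mono_iff_ff_pairing[OF g h] n fac'(2) by simp
    then have "(a \<cdot> k) \<cdot> l \<preceq> (b \<cdot> k) \<cdot> l"
      using jointly_order_mono_le[OF _ akl bkl gle hle] by blast
    then show ?thesis
      using so_order_epi[OF k(1,2) a b] so_order_epi[OF l(1,2) ak bk] by blast
  qed
  then have ff_g: "ff_mor C g"
    using homD[OF g] by (auto simp: ff_mor_def)
  \<comment> \<open>The square from \<open>e\<close> to \<open>g\<close> with the identity of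
    \<open>X\<close> at the bottom has a diagonal, which is a section of \<open>g\<close>.\<close>
  have "g \<cdot> q = Ide C X \<cdot> e"
    using gq comp_ide_left[OF e(2)] by simp
  then obtain j where j: "j \<in> hom C X G" "j \<cdot> e = q" "g \<cdot> j = Ide C X"
    by (rule so_diagonal[OF e ff_g g fac'(3) ide_hom[OF objs(1)]])
  define f where "f = h \<cdot> j"
  have f: "f \<in> hom C X Y"
    unfolding f_def by (rule comp_hom[OF j(1) h])
  have fe: "f \<cdot> e = y"
    using comp_assoc[OF e(2) j(1) h] j(2) hq by (simp add: f_def)
  note ide = ide_hom[OF objs(1)]
  \<comment> \<open>Both memberships hold after restriction along \<open>e\<close>, where
    \<open>f\<close> becomes \<open>y\<close>, and so they descend to \<open>X\<close>.\<close>
  have fR: "in_rel C (Ide C X) f R"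
    using in_rel_so_descent[OF R e ide f] eyR fe comp_ide_left[OF e(2)] by simp
  have fS: "in_rel C f (Ide C X) S"
    using in_rel_so_descent[OF S e f ide] eyS fe comp_ide_left[OF e(2)] by simp
  have "in_rel C u v R \<longleftrightarrow> f \<cdot> u \<preceq> v" if u: "u \<in> hom C B X" and v: "v \<in> hom C B Y" for B u v
  proof
    note fu = comp_hom[OF u f]
    \<comment> \<open>This feeds the counit for the forward implication; the converse enlarges the
      second component of the pair of \<open>u\<close> and \<open>f \<cdot> u\<close> by
      weakening.\<close>
    have "in_rel C (f \<cdot> u) u S"
      using in_rel_comp[OF S f ide u fS] comp_ide_left[OF u] by simp
    then show "f \<cdot> u \<preceq> v" if "in_rel C u v R"
      using counit[OF fu u v] that by blast
    have "in_rel C u (f \<cdot> u) R"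
      using in_rel_comp[OF R ide f u fR] comp_ide_left[OF u] by simp
    then show "in_rel C u v R" if "f \<cdot> u \<preceq> v"
      using w that le_refl[OF u] u v fu hom_dom_obj[OF u] unfolding weakening_closed_def by blast
  qed
  with f show thesis by (rule that)
qed

text \<open>Equality here is equality of sets of representatives. By \<open>mem\<close>, the legs of
  each \<open>r\<close> in \<open>R\<close> form a comma object; conversely, each pairing of comma
  legs factors through \<open>r\<close> and \<open>r\<close> through it, so saturation of
  \<open>R\<close> applies.\<close>

lemma eq_comma_rel:
  assumes R: "R \<in> subobjects C (prod_obj C X Y)" and f: "f \<in> hom C X Y"
    and mem: "\<And>B u v. \<lbrakk>u \<in> hom C B X; v \<in> hom C B Y\<rbrakk> \<Longrightarrow> in_rel C u v R \<longleftrightarrow> f \<cdot> u \<preceq> v"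
  shows "R = comma_rel C f (Ide C Y)"
proof
  note objs = hom_dom_obj[OF f] hom_cod_obj[OF f]
  note ide = ide_hom[OF objs(2)]
  have legs: "proj\<^sub>0 C X Y \<cdot> r \<in> hom C (Dom C r) X" "proj\<^sub>1 C X Y \<cdot> r \<in> hom C (Dom C r) Y"
    "pairing C (proj\<^sub>0 C X Y \<cdot> r) (proj\<^sub>1 C X Y \<cdot> r) = r"
    "f \<cdot> (proj\<^sub>0 C X Y \<cdot> r) \<preceq> proj\<^sub>1 C X Y \<cdot> r" if r: "r \<in> R" for r
  proof -
    note rh = subobject_ff(2)[OF R r]
    show l: "proj\<^sub>0 C X Y \<cdot> r \<in> hom C (Dom C r) X" "proj\<^sub>1 C X Y \<cdot> r \<in> hom C (Dom C r) Y"
      by (rule rel_legs[OF objs rh])+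
    show p: "pairing C (proj\<^sub>0 C X Y \<cdot> r) (proj\<^sub>1 C X Y \<cdot> r) = r"
      by (rule pairing_unique[OF objs rh])
    show "f \<cdot> (proj\<^sub>0 C X Y \<cdot> r) \<preceq> proj\<^sub>1 C X Y \<cdot> r"
      using in_rel_iff[OF R r l] mem[OF l] p factors_through_refl[OF homD(1)[OF rh]] by simp
  qed
  show "R \<subseteq> comma_rel C f (Ide C Y)"
  proof
    fix r assume r: "r \<in> R"
    note l = legs[OF r] and rh = subobject_ff[OF R r]
    have lift: "\<exists>h \<in> hom C A (Dom C r). (proj\<^sub>0 C X Y \<cdot> r) \<cdot> h = u \<and> (proj\<^sub>1 C X Y \<cdot> r) \<cdot> h = v"
      if u: "u \<in> hom C A X" and v: "v \<in> hom C A Y" and le: "f \<cdot> u \<preceq> Ide C Y \<cdot> v" for A u v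
      using in_rel_iff[OF R r u v] pairing_factors_iff[OF rh(2) u v] mem[OF u v] le
        comp_ide_left[OF v] by simp
    have mono: "jointly_order_mono C (Dom C r) (proj\<^sub>0 C X Y \<cdot> r) (proj\<^sub>1 C X Y \<cdot> r)"
      using jointly_order_mono_iff_ff_pairing[OF l(1,2)] l(3) rh(1) by simp
    have "is_comma C f (Ide C Y) (Dom C r) (proj\<^sub>0 C X Y \<cdot> r) (proj\<^sub>1 C X Y \<cdot> r)"
      unfolding is_comma_def homD[OF f] homD[OF ide]
      using homD(1)[OF f] homD(1)[OF ide] hom_dom_obj[OF rh(2)] l mono lift
        comp_ide_left[OF l(2)] by simp
    then show "r \<in> comma_rel C f (Ide C Y)"
      unfolding comma_rel_def using l(3) by (metis (mono_tags, lifting) mem_Collect_eq)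
  qed
  show "comma_rel C f (Ide C Y) \<subseteq> R"
  proof
    fix m assume "m \<in> comma_rel C f (Ide C Y)"
    then obtain K c\<^sub>0 c\<^sub>1 where m: "m = pairing C c\<^sub>0 c\<^sub>1" and K: "is_comma C f (Ide C Y) K c\<^sub>0 c\<^sub>1"
      unfolding comma_rel_def by blast
    then have c: "c\<^sub>0 \<in> hom C K X" "c\<^sub>1 \<in> hom C K Y" "jointly_order_mono C K c\<^sub>0 c\<^sub>1"
      "f \<cdot> c\<^sub>0 \<preceq> Ide C Y \<cdot> c\<^sub>1"
      by (auto simp: is_comma_def homD[OF f] homD[OF ide])
    obtain r where r: "r \<in> R" by (rule subobject_rep[OF R])
    note l = legs[OF r]
    have "factors_through C r m"
      using pairing_comma_factors_iff[OF K f ide l(1,2)] l(3,4) comp_ide_left[OF l(2)] m by simp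
    moreover have "factors_through C m r"
      using in_rel_iff[OF R r c(1,2)] mem[OF c(1,2)] c(4) comp_ide_left[OF c(2)] m by simp
    moreover have "ff_mor C m"
      using jointly_order_mono_iff_ff_pairing[OF c(1,2)] c(3) m by simp
    ultimately show "m \<in> R"
      using subobject_closed[OF R r] pairing(1)[OF c(1,2)] m by blast
  qed
qed

text \<open>Testing the common representative on the pairs of \<open>Ide C X\<close> and
  \<open>h\<close> shows that \<open>f\<close> and \<open>g\<close> lie below the same arrows
  \<open>h\<close>. Taking \<open>h\<close> to be \<open>f\<close> and \<open>g\<close> gives both
  inequalities.\<close>

lemma comma_rel_inject:
  assumes f: "f \<in> hom C X Y" and g: "g \<in> hom C X Y"
    and m: "m \<in> comma_rel C f (Ide C Y)" "m \<in> comma_rel C g (Ide C Y)"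
  shows "f = g"
proof -
  note ideX = ide_hom[OF hom_dom_obj[OF f]] and ideY = ide_hom[OF hom_cod_obj[OF f]]
  have "f' \<cdot> Ide C X \<preceq> Ide C Y \<cdot> h \<longleftrightarrow> factors_through C (pairing C (Ide C X) h) m"
    if "f' \<in> hom C X Y" "h \<in> hom C X Y" "m \<in> comma_rel C f' (Ide C Y)" for f' h
    using that pairing_comma_factors_iff[OF _ that(1) ideY ideX that(2)]
    unfolding comma_rel_def by blast
  then have "f \<preceq> h \<longleftrightarrow> g \<preceq> h" if "h \<in> hom C X Y" for h
    using f g m that comp_ide_left[OF that] comp_ide_right[OF f] comp_ide_right[OF g] by metis
  then show ?thesis
    using le_antisym[OF f g] le_refl f g by blast
qed

lemma comma_ide_factors_iff:
  assumes m: "m \<in> comma_rel C (Ide C X) (Ide C X)" and x: "x \<in> hom C A X" and y: "y \<in> hom C A X"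
  shows "factors_through C (pairing C x y) m \<longleftrightarrow> x \<preceq> y"
    and "m \<in> hom C (Dom C m) (prod_obj C X X)"
proof -
  note ide = ide_hom[OF hom_cod_obj[OF x]]
  obtain K c\<^sub>0 c\<^sub>1 where K: "m = pairing C c\<^sub>0 c\<^sub>1" "is_comma C (Ide C X) (Ide C X) K c\<^sub>0 c\<^sub>1"
    using m unfolding comma_rel_def by blast
  then show "factors_through C (pairing C x y) m \<longleftrightarrow> x \<preceq> y"
    using pairing_comma_factors_iff[OF K(2) ide ide x y] comp_ide_left[OF x] comp_ide_left[OF y]
    by simp
  have "c\<^sub>0 \<in> hom C K X" "c\<^sub>1 \<in> hom C K X"
    using K(2) by (auto simp: is_comma_def homD[OF ide])
  then have "m \<in> hom C K (prod_obj C X X)"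
    using pairing(1) K(1) by blast
  then show "m \<in> hom C (Dom C m) (prod_obj C X X)"
    by (simp add: homD(2))
qed

lemma rel_comp_hom:
  assumes "S \<in> subobjects C (prod_obj C Y Z)" "R \<in> subobjects C (prod_obj C X Y)"
    "X \<in> Obj C" "Y \<in> Obj C" "Z \<in> Obj C" "n \<in> rel_comp C X Y Z S R"
  shows "n \<in> hom C (Dom C n) (prod_obj C X Z)"
  by (rule rel_comp_legs[OF assms])

end

theorem theorem3p8:
  fixes E :: "('o, 'a) pos_cat" and X Y :: 'o and \<phi> :: "'o \<times> 'a set \<times> 'o"
  assumes "regular_pos_category E"
    and "X \<in> Obj E" and "Y \<in> Obj E"
    and "\<phi> \<in> hom (Rel_w E) X Y"
    and "has_right_adjoint (Rel_w E) \<phi>"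
  shows "\<exists>!f. f \<in> hom E X Y \<and> \<phi> = lower_star E f"
proof -
  interpret regular_pos_category E by fact
  from assms(4) obtain R where \<phi>: "\<phi> = (X, R, Y)"
    and R: "R \<in> subobjects E (prod_obj E X Y)" and w: "weakening_closed E X Y R"
    by (auto simp: hom_def Rel_w_def)
  from assms(5) obtain S where S: "S \<in> subobjects E (prod_obj E Y X)"
    and unit: "sub_le E (comma_rel E (Ide E X) (Ide E X)) (rel_comp E X Y X S R)"
    and counit: "sub_le E (rel_comp E Y X Y R S) (comma_rel E (Ide E Y) (Ide E Y))"
    by (auto simp: has_right_adjoint_def \<phi> hom_def Rel_w_def)
  note ideX = ide_hom[OF assms(2)]
  obtain m n where m: "m \<in> comma_rel E (Ide E X) (Ide E X)"
    and n: "n \<in> rel_comp E X Y X S R" and mn: "factors_through E m n"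
    using unit by (auto simp: sub_le_def)
  \<comment> \<open>The diagonal pair of identities is the generic element of the order on
    \<open>X\<close>, so the unit places it in \<psi>\<phi>; \<open>rel_comp_elim\<close> then
    produces the cover \<open>e\<close> and the element \<open>y\<close>.\<close>
  have "factors_through E (pairing E (Ide E X) (Ide E X)) n"
    using factors_through_trans[OF pairing(1)[OF ideX ideX] comma_ide_factors_iff(2)[OF m ideX ideX]
        rel_comp_hom[OF S R assms(2,3,2) n] _ mn]
      comma_ide_factors_iff(1)[OF m ideX ideX] le_refl[OF ideX] by blast
  then obtain A e y where e: "so_mor E e" "e \<in> hom E A X" and y: "y \<in> hom E A Y"
    and R_ey: "in_rel E (Ide E X \<cdot>\<^bsub>E\<^esub> e) y R" and S_ye: "in_rel E y (Ide E X \<cdot>\<^bsub>E\<^esub> e) S"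
    by (rule rel_comp_elim[OF S R ideX ideX assms(3) n])
  obtain p q where p: "p \<in> rel_comp E Y X Y R S" and q: "q \<in> comma_rel E (Ide E Y) (Ide E Y)"
    and pq: "factors_through E p q"
    using counit by (auto simp: sub_le_def)
  \<comment> \<open>The counit on elements: a pair linked through \<open>u\<close> lies in
    \<phi>\<psi>, hence in the order of \<open>Y\<close>.\<close>
  have "v \<preceq>\<^bsub>E\<^esub> v'"
    if v: "v \<in> hom E B Y" and u: "u \<in> hom E B X" and v': "v' \<in> hom E B Y"
      and "in_rel E v u S" "in_rel E u v' R" for B v u v'
    using factors_through_trans[OF pairing(1)[OF v v'] rel_comp_hom[OF R S assms(3,2,3) p]
        comma_ide_factors_iff(2)[OF q v v'] rel_comp_intro[OF R S v u v' that(4,5) p] pq]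
      comma_ide_factors_iff(1)[OF q v v'] by blast
  then obtain f where f: "f \<in> hom E X Y"
    and "\<And>B u v. \<lbrakk>u \<in> hom E B X; v \<in> hom E B Y\<rbrakk> \<Longrightarrow> in_rel E u v R \<longleftrightarrow> f \<cdot>\<^bsub>E\<^esub> u \<preceq>\<^bsub>E\<^esub> v"
    using graph_of_adjoint[OF R S w e y] R_ey S_ye comp_ide_left[OF e(2)] by metis
  then have "R = comma_rel E f (Ide E Y)"
    using eq_comma_rel[OF R f] by blast
  then have "\<phi> = lower_star E f"
    by (simp add: \<phi> lower_star_def homD[OF f])
  \<comment> \<open>Both comma relations are the class \<open>R\<close>, which is nonempty, so they
    share a representative.\<close>
  moreover have "g = f" if "g \<in> hom E X Y" "\<phi> = lower_star E g" for g
  proof -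
    obtain r where "r \<in> R" by (rule subobject_rep[OF R])
    then show ?thesis
      using comma_rel_inject[OF that(1) f] that(2) \<open>R = comma_rel E f (Ide E Y)\<close>
      by (simp add: \<phi> lower_star_def homD[OF that(1)])
  qed
  ultimately show ?thesis
    using f by blast
qed

end
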